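(* Let $p<17$ be a prime. Then there does not exist a set of eight points in general position in $\mathbb{P}^2(\mathbb{F}_p)$.
   Context: Eight points in $\mathbb{P}^2$ are in general position if no line contains three of them, no conic contains six of them, and no cubic contains all eight of them with a singularity at one of them. *)

theory Defs
  imports
    "HOL-Analysis.Cartesian_Space"
    "HOL-Library.Poly_Mapping"
    "Berlekamp_Zassenhaus.Finite_Field"
begin

text \<open>The points of the projective plane are the lines through the origin of the 3-space.\<close>

definition proj_plane :: "('a::field ^ 3) set set" where
  "proj_plane = {vec.span {v} | v. v \<noteq> 0}"

text \<open>Polynomials in three variables: finitely supported maps from exponent vectors to
  coefficients.  Over a finite field these must not be confused with polynomial functions.\<close>

type_synonym 'a ternary_poly = "(3 \<Rightarrow>\<^sub>0 nat) \<Rightarrow>\<^sub>0 'a"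

definition poly_eval :: "'a::comm_semiring_1 ternary_poly \<Rightarrow> 'a ^ 3 \<Rightarrow> 'a" where
  "poly_eval F x =
     (\<Sum>m\<in>Poly_Mapping.keys F.
        Poly_Mapping.lookup F m * (\<Prod>i\<in>UNIV. (x $ i) ^ Poly_Mapping.lookup m i))"

text \<open>The truncated subtraction on exponents is harmless: where it truncates, the
  coefficient is 0.\<close>

definition partial_deriv :: "3 \<Rightarrow> 'a::comm_semiring_1 ternary_poly \<Rightarrow> 'a ternary_poly" where
  "partial_deriv i F =
     (\<Sum>m\<in>Poly_Mapping.keys F.
        Poly_Mapping.single (m - Poly_Mapping.single i 1)
          (of_nat (Poly_Mapping.lookup m i) * Poly_Mapping.lookup F m))"

definition homogeneous :: "nat \<Rightarrow> 'a::zero ternary_poly \<Rightarrow> bool" where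
  "homogeneous d F \<longleftrightarrow>
     (\<forall>m\<in>Poly_Mapping.keys F. (\<Sum>i\<in>UNIV. Poly_Mapping.lookup m i) = d)"

text \<open>A plane curve of degree \<open>d\<close> (line, conic, cubic for \<open>d = 1, 2, 3\<close>) is given by a
  nonzero form of degree \<open>d\<close>; reducible and non-reduced curves are allowed.\<close>

definition plane_curve :: "nat \<Rightarrow> 'a::zero ternary_poly \<Rightarrow> bool" where
  "plane_curve d F \<longleftrightarrow> F \<noteq> 0 \<and> homogeneous d F"

definition vanishes_at :: "'a::field ternary_poly \<Rightarrow> ('a ^ 3) set \<Rightarrow> bool" where
  "vanishes_at F P \<longleftrightarrow> (\<forall>x\<in>P - {0}. poly_eval F x = 0)"

text \<open>The vanishing of \<open>F\<close> itself has to be required, as the characteristic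
  may divide the degree.\<close>

definition singular_at :: "'a::field ternary_poly \<Rightarrow> ('a ^ 3) set \<Rightarrow> bool" where
  "singular_at F P \<longleftrightarrow> vanishes_at F P \<and> (\<forall>i. vanishes_at (partial_deriv i F) P)"

definition eight_points_in_general_position :: "('a::field ^ 3) set set \<Rightarrow> bool" where
  "eight_points_in_general_position S \<longleftrightarrow>
     S \<subseteq> proj_plane \<and> card S = 8 \<and>
     \<not> (\<exists>L. plane_curve 1 L \<and> (\<exists>T\<subseteq>S. card T = 3 \<and> (\<forall>P\<in>T. vanishes_at L P))) \<and>
     \<not> (\<exists>Q. plane_curve 2 Q \<and> (\<exists>T\<subseteq>S. card T = 6 \<and> (\<forall>P\<in>T. vanishes_at Q P))) \<and>
     \<not> (\<exists>C. plane_curve 3 C \<and> (\<forall>P\<in>S. vanishes_at C P) \<and> (\<exists>P\<in>S. singular_at C P))"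

end

theory Submission imports Defs begin

text \<open>
Let \<open>q\<close> be the order of the field.  The seven points other than a chosen one, \<open>O\<close>, lie on distinct
lines through \<open>O\<close>, so \<open>7 \<le> q + 1\<close>; this leaves \<open>q = 7, 11, 13\<close>.

The cubics through the eight points contain a pencil.  Two generators restrict to quadratics on
the lines through \<open>O\<close>, and their resultant is a binary octic vanishing at the seven lines that join
\<open>O\<close> to the other points.  Its eighth root gives a ninth base point; it is not one of the eight,
since a double root would make some member of the pencil singular at one of the points.  As
every further point lies on some member, the \<open>q + 1\<close> members have together at least
\<open>q\<^sup>2 + 10 q + 1\<close> rational points.

No member contains a line, because a line and a conic contain at most \<open>2 + 5\<close> of the points.
Projection from \<open>O\<close> then turns a member into a curve \<open>w\<^sup>2 = D(u)\<close> with \<open>D\<close> of degree 3, or of degree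
4 and not a square, and finally into a cubic \<open>w\<^sup>2 = u\<^sup>3 + a u + b\<close>.  Enumeration shows that these have
at most 13, 18, 20 affine points for \<open>q = 7, 11, 13\<close>, hence each member has at most 14, 19, 21
points, and \<open>8 \<cdot> 14 < 120\<close>, \<open>12 \<cdot> 19 < 232\<close>, \<open>14 \<cdot> 21 < 300\<close>.  The counting is done with vectors
instead of projective points.
\<close>

section \<open>Ternary forms as functions\<close>

text \<open>Evaluation of a polynomial and evaluation of its partial derivatives are both of this
  shape, with different weights on the monomials. The rules for sums and products are therefore
  proved once, for arbitrary \<open>g\<close>.\<close>

definition weighted_sum :: "('m \<Rightarrow> 'a) \<Rightarrow> ('m \<Rightarrow>\<^sub>0 'a::comm_ring_1) \<Rightarrow> 'a" where
  "weighted_sum g F = (\<Sum>m\<in>Poly_Mapping.keys F. Poly_Mapping.lookup F m * g m)"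

lemma weighted_sum_superset:
  "finite S \<Longrightarrow> Poly_Mapping.keys F \<subseteq> S \<Longrightarrow> weighted_sum g F = (\<Sum>m\<in>S. Poly_Mapping.lookup F m * g m)"
  unfolding weighted_sum_def by (rule sum.mono_neutral_left) (auto simp: in_keys_iff)

lemma weighted_sum_add: "weighted_sum g (F + G) = weighted_sum g F + weighted_sum g G"
proof -
  let ?S = "Poly_Mapping.keys F \<union> Poly_Mapping.keys G"
  have "weighted_sum g (F + G) = (\<Sum>m\<in>?S. Poly_Mapping.lookup (F + G) m * g m)"
    by (rule weighted_sum_superset) (auto simp: keys_add)
  also have "\<dots> = weighted_sum g F + weighted_sum g G"
    by (simp add: weighted_sum_superset[of ?S] lookup_add distrib_right sum.distrib)
  finally show ?thesis .
qed

lemma weighted_sum_zero [simp]: "weighted_sum g 0 = 0"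
  by (simp add: weighted_sum_def)

lemma weighted_sum_single [simp]: "weighted_sum g (Poly_Mapping.single m c) = c * g m"
  by (simp add: weighted_sum_def)

lemma weighted_sum_sum: "weighted_sum g (\<Sum>i\<in>I. F i) = (\<Sum>i\<in>I. weighted_sum g (F i))"
  by (induction I rule: infinite_finite_induct) (auto simp: weighted_sum_add)

lemma sum_of_singles: "(\<Sum>m\<in>Poly_Mapping.keys F. Poly_Mapping.single m (Poly_Mapping.lookup F m)) = F"
  by (rule poly_mapping_eqI) (auto simp: lookup_sum lookup_single when_def in_keys_iff)

text \<open>Reduces the product rule for values and the Leibniz rule for derivatives to identities
  between weights of single monomials.\<close>

lemma weighted_sum_mult:
  "weighted_sum g (F * G) = (\<Sum>m\<in>Poly_Mapping.keys F. \<Sum>n\<in>Poly_Mapping.keys G.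
     Poly_Mapping.lookup F m * Poly_Mapping.lookup G n * g (m + n))"
proof -
  have "F * G = (\<Sum>m\<in>Poly_Mapping.keys F. \<Sum>n\<in>Poly_Mapping.keys G.
     Poly_Mapping.single (m + n) (Poly_Mapping.lookup F m * Poly_Mapping.lookup G n))"
    by (subst (1 2) sum_of_singles[symmetric]) (simp add: sum_product mult_single)
  thus ?thesis by (simp add: weighted_sum_sum)
qed

section \<open>Values and derivatives of monomials\<close>

definition monom_eval :: "'a::comm_ring_1 ^ 3 \<Rightarrow> (3 \<Rightarrow>\<^sub>0 nat) \<Rightarrow> 'a" where
  "monom_eval x m = (\<Prod>i\<in>UNIV. (x $ i) ^ Poly_Mapping.lookup m i)"

definition monom_deriv :: "3 \<Rightarrow> 'a::comm_ring_1 ^ 3 \<Rightarrow> (3 \<Rightarrow>\<^sub>0 nat) \<Rightarrow> 'a" where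
  "monom_deriv i x m = of_nat (Poly_Mapping.lookup m i) * monom_eval x (m - Poly_Mapping.single i 1)"

abbreviation monom_degree :: "(3 \<Rightarrow>\<^sub>0 nat) \<Rightarrow> nat" where
  "monom_degree m \<equiv> (\<Sum>i\<in>UNIV. Poly_Mapping.lookup m i)"

lemma poly_eval_weighted: "poly_eval F x = weighted_sum (monom_eval x) F"
  by (simp add: poly_eval_def weighted_sum_def monom_eval_def)

lemma poly_eval_partial_weighted: "poly_eval (partial_deriv i F) x = weighted_sum (monom_deriv i x) F"
  by (simp add: poly_eval_weighted partial_deriv_def weighted_sum_sum weighted_sum_def[of _ F] monom_deriv_def mult_ac)

lemma monom_eval_add: "monom_eval x (m + n) = monom_eval x m * monom_eval x n"
  by (simp add: monom_eval_def lookup_add power_add prod.distrib)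

lemma monom_split:
  assumes "Poly_Mapping.lookup m i \<noteq> 0"
  shows "m = (m - Poly_Mapping.single i 1) + Poly_Mapping.single i (1::nat)"
  using assms by (intro poly_mapping_eqI) (auto simp: lookup_add lookup_minus lookup_single when_def)

lemma monom_deriv_add:
  "monom_deriv i x (m + n) = monom_deriv i x m * monom_eval x n + monom_eval x m * monom_deriv i x n"
proof -
  \<comment> \<open>One half of the Leibniz rule: the exponent of the \<open>i\<close>-th variable
    in \<open>m + n\<close> splits into two summands, and this handles the summand from
    \<open>m\<close>. The other half follows by exchanging \<open>m\<close> and
    \<open>n\<close>.\<close>
  have *: "of_nat (Poly_Mapping.lookup m i) * monom_eval x (m + n - Poly_Mapping.single i 1)
      = monom_deriv i x m * monom_eval x n" for m n
  proof (cases "Poly_Mapping.lookup m i = 0")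
    case True
    then show ?thesis by (simp add: monom_deriv_def)
  next
    case False
    define m' where "m' = m - Poly_Mapping.single i 1"
    have m: "m = m' + Poly_Mapping.single i 1" using monom_split[OF False] by (simp add: m'_def)
    have "m + n - Poly_Mapping.single i 1 = m' + n"
      unfolding m by (rule poly_mapping_eqI) (simp add: lookup_add lookup_minus)
    hence "m + n - Poly_Mapping.single i 1 = (m - Poly_Mapping.single i 1) + n" by (simp add: m'_def)
    thus ?thesis by (simp add: monom_deriv_def monom_eval_add)
  qed
  show ?thesis using *[of m n] *[of n m]
    by (simp add: monom_deriv_def[of i x "m + n"] lookup_add distrib_right add.commute mult.commute)
qed

lemma monom_eval_scale: "monom_eval (c *s x) m = c ^ monom_degree m * monom_eval x m"
  by (simp add: monom_eval_def power_mult_distrib prod.distrib power_sum)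

text \<open>The subtraction in the exponent truncates only in degree 0, where the derivative is 0
  anyway.\<close>

lemma monom_deriv_scale: "monom_deriv i (c *s x) m = c ^ (monom_degree m - 1) * monom_deriv i x m"
proof (cases "Poly_Mapping.lookup m i = 0")
  case True
  then show ?thesis by (simp add: monom_deriv_def)
next
  case False
  define m' where "m' = m - Poly_Mapping.single i 1"
  have "m = m' + Poly_Mapping.single i 1" using monom_split[OF False] by (simp add: m'_def)
  hence "monom_degree m = monom_degree m' + 1"
    by (simp add: lookup_add sum.distrib lookup_single when_def)
  thus ?thesis unfolding monom_deriv_def m'_def[symmetric] monom_eval_scale by (simp add: mult_ac)
qed

lemma poly_eval_scale:
  fixes F :: "'a::comm_ring_1 ternary_poly"
  shows "homogeneous d F \<Longrightarrow> poly_eval F (c *s x) = c ^ d * poly_eval F x"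
  unfolding poly_eval_weighted weighted_sum_def sum_distrib_left
  by (rule sum.cong) (auto simp: homogeneous_def monom_eval_scale)

lemma poly_eval_partial_scale:
  fixes F :: "'a::comm_ring_1 ternary_poly"
  shows "homogeneous d F \<Longrightarrow> poly_eval (partial_deriv i F) (c *s x) = c ^ (d - 1) * poly_eval (partial_deriv i F) x"
  unfolding poly_eval_partial_weighted weighted_sum_def sum_distrib_left
  by (rule sum.cong) (auto simp: homogeneous_def monom_deriv_scale)

text \<open>Forms are handled through the functions that they and their partial derivatives induce.\<close>

definition form :: "nat \<Rightarrow> ('a::comm_ring_1 ^ 3 \<Rightarrow> 'a) \<Rightarrow> (3 \<Rightarrow> 'a ^ 3 \<Rightarrow> 'a) \<Rightarrow> bool" where
  "form d f D \<longleftrightarrow> (\<exists>F. homogeneous d F \<and> (\<forall>x. poly_eval F x = f x)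
     \<and> (\<forall>i x. poly_eval (partial_deriv i F) x = D i x))"

lemma form_cong:
  "form d f D \<Longrightarrow> (\<And>x. f x = f' x) \<Longrightarrow> (\<And>i x. D i x = D' i x) \<Longrightarrow> form d f' D'"
  unfolding form_def by simp

lemma form_add:
  assumes "form d f D" "form d g E"
  shows "form d (\<lambda>x. f x + g x) (\<lambda>i x. D i x + E i x)"
proof -
  obtain F where F: "homogeneous d F" "\<And>x. poly_eval F x = f x" "\<And>i x. poly_eval (partial_deriv i F) x = D i x"
    using assms(1) unfolding form_def by blast
  obtain G where G: "homogeneous d G" "\<And>x. poly_eval G x = g x" "\<And>i x. poly_eval (partial_deriv i G) x = E i x"
    using assms(2) unfolding form_def by blast
  have "homogeneous d (F + G)" using F(1) G(1) keys_add[of F G] by (auto simp: homogeneous_def)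
  moreover have "poly_eval (F + G) x = f x + g x" for x
    unfolding F(2)[symmetric] G(2)[symmetric] poly_eval_weighted weighted_sum_add ..
  moreover have "poly_eval (partial_deriv i (F + G)) x = D i x + E i x" for i x
    unfolding F(3)[symmetric] G(3)[symmetric] poly_eval_partial_weighted weighted_sum_add ..
  ultimately show ?thesis unfolding form_def by blast
qed

lemma form_mult:
  assumes "form d f D" "form e g E"
  shows "form (d + e) (\<lambda>x. f x * g x) (\<lambda>i x. D i x * g x + f x * E i x)"
proof -
  obtain F where F: "homogeneous d F" "\<And>x. poly_eval F x = f x" "\<And>i x. poly_eval (partial_deriv i F) x = D i x"
    using assms(1) unfolding form_def by blast
  obtain G where G: "homogeneous e G" "\<And>x. poly_eval G x = g x" "\<And>i x. poly_eval (partial_deriv i G) x = E i x"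
    using assms(2) unfolding form_def by blast
  have "homogeneous (d + e) (F * G)"
    using F(1) G(1) keys_mult[of F G] by (fastforce simp: homogeneous_def lookup_add sum.distrib)
  moreover have "poly_eval (F * G) x = f x * g x" for x
    unfolding F(2)[symmetric] G(2)[symmetric] poly_eval_weighted weighted_sum_mult
    unfolding weighted_sum_def sum_product by (intro sum.cong refl) (simp add: monom_eval_add)
  moreover have "poly_eval (partial_deriv i (F * G)) x = D i x * g x + f x * E i x" for i x
    unfolding F(2,3)[symmetric] G(2,3)[symmetric] poly_eval_partial_weighted
    unfolding poly_eval_weighted weighted_sum_mult
    unfolding weighted_sum_def sum_product sum.distrib[symmetric]
    by (intro sum.cong refl) (simp add: monom_deriv_add algebra_simps)
  ultimately show ?thesis unfolding form_def by blast
qed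

lemma form_const: "form 0 (\<lambda>x. c) (\<lambda>i x. 0)"
  unfolding form_def poly_eval_partial_weighted
  by (intro exI[of _ "Poly_Mapping.single 0 c"])
    (auto simp: homogeneous_def poly_eval_weighted monom_eval_def monom_deriv_def split: if_splits)

definition lin :: "'a::comm_ring_1 ^ 3 \<Rightarrow> 'a ^ 3 \<Rightarrow> 'a" where
  "lin a x = (\<Sum>i\<in>UNIV. a $ i * x $ i)"

lemma form_lin: "form 1 (lin a) (\<lambda>i x. a $ i)"
proof -
  define F where "F = (\<Sum>i\<in>UNIV. Poly_Mapping.single (Poly_Mapping.single i 1) (a $ i) :: 'a ternary_poly)"
  have "homogeneous 1 F" unfolding homogeneous_def
  proof
    fix m assume m: "m \<in> Poly_Mapping.keys F"
    obtain i where "m \<in> Poly_Mapping.keys (Poly_Mapping.single (Poly_Mapping.single i (1::nat)) (a $ i))"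
      using subsetD[OF keys_sum m[unfolded F_def]] by (rule UN_E)
    hence "m = Poly_Mapping.single i 1" by (auto split: if_splits)
    thus "monom_degree m = 1" by (simp add: lookup_single when_def)
  qed
  moreover have "monom_eval x (Poly_Mapping.single i 1) = x $ i" for x :: "'a ^ 3" and i
    unfolding monom_eval_def lookup_single when_def by (subst prod.remove[of _ i]) auto
  hence "poly_eval F x = lin a x" for x
    by (simp add: poly_eval_weighted F_def weighted_sum_sum lin_def)
  moreover have "monom_deriv j x (Poly_Mapping.single i 1) = (if i = j then 1 else 0)" for x :: "'a ^ 3" and i j
    by (simp add: monom_deriv_def lookup_single when_def monom_eval_def)
  hence "poly_eval (partial_deriv j F) x = (\<Sum>i\<in>UNIV. if i = j then a $ i else 0)" for j x
    unfolding poly_eval_partial_weighted F_def weighted_sum_sum weighted_sum_single by (intro sum.cong) auto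
  hence "poly_eval (partial_deriv j F) x = a $ j" for j x by simp
  ultimately show ?thesis unfolding form_def by blast
qed

lemma lin_add: "lin (a + b) x = lin a x + lin b x" and lin_smult: "lin (c *s a) x = c * lin a x"
  by (simp_all add: lin_def distrib_right sum.distrib sum_distrib_left mult.assoc)

lemma lin_smult_right: "lin a (c *s x) = c * lin a x"
  by (simp add: lin_def sum_distrib_left mult_ac)

lemma lin_diff_right: "lin a (x - y) = lin a x - lin a y"
  by (simp add: lin_def right_diff_distrib sum_subtractf)

lemma form_scaled_product2:
  "form 2 (\<lambda>x. k * (lin p x * lin q x)) (\<lambda>i x. k * (p $ i * lin q x + lin p x * q $ i))"
proof -
  have "form (0 + (1 + 1)) (\<lambda>x. k * (lin p x * lin q x))
     (\<lambda>i x. 0 * (lin p x * lin q x) + k * (p $ i * lin q x + lin p x * q $ i))"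
    by (intro form_mult form_const form_lin)
  thus ?thesis by (simp add: numeral_2_eq_2)
qed

text \<open>Building block for cubics in arbitrary linear coordinates: each monomial of degree 3 in
  the coordinates is such a product.\<close>

lemma form_scaled_product3:
  "form 3 (\<lambda>x. k * (lin p x * lin q x * lin r x))
     (\<lambda>i x. k * (p $ i * lin q x * lin r x + lin p x * q $ i * lin r x + lin p x * lin q x * r $ i))"
proof -
  have "form (2 + 1) (\<lambda>x. k * (lin p x * lin q x) * lin r x)
     (\<lambda>i x. k * (p $ i * lin q x + lin p x * q $ i) * lin r x + k * (lin p x * lin q x) * r $ i)"
    by (rule form_mult[OF form_scaled_product2 form_lin])
  hence "form 3 (\<lambda>x. k * (lin p x * lin q x) * lin r x)
     (\<lambda>i x. k * (p $ i * lin q x + lin p x * q $ i) * lin r x + k * (lin p x * lin q x) * r $ i)"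
    by simp
  thus ?thesis by (rule form_cong) (simp_all add: algebra_simps)
qed

section \<open>Counting points on plane cubics\<close>

definition square_root_counts :: "nat \<Rightarrow> nat list" where
  "square_root_counts p = map (\<lambda>t. length (filter (\<lambda>j. (j * j) mod p = t) [0..<p])) [0..<p]"

text \<open>With \<open>r\<close> the table of square root counts, each sum is the number of affine
  points of one curve. All pairs \<open>(a, b)\<close> are covered, those with a singular curve
  included, since a member of the pencil may be singular away from the eight points.\<close>

definition cubic_counts_le :: "nat \<Rightarrow> nat list \<Rightarrow> nat \<Rightarrow> bool" where
  "cubic_counts_le p r B \<longleftrightarrow>
     list_all (\<lambda>a. list_all (\<lambda>b. sum_list (map (\<lambda>i. r ! ((i * i * i + a * i + b) mod p)) [0..<p]) \<le> B)
       [0..<p]) [0..<p]"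

lemma card_cubic_curve_le:
  fixes a b :: "'p::prime_card mod_ring"
  assumes "cubic_counts_le CARD('p) (square_root_counts CARD('p)) B"
  shows "card {(u, w). w^2 = u^3 + a * u + b} \<le> B"
proof -
  let ?p = "CARD('p)"
  obtain \<alpha> where \<alpha>: "\<alpha> < ?p" "a = of_nat \<alpha>" using surj_of_nat_mod_ring by blast
  obtain \<beta> where \<beta>: "\<beta> < ?p" "b = of_nat \<beta>" using surj_of_nat_mod_ring by blast
  define g where "g = (\<lambda>i. (i * i * i + \<alpha> * i + \<beta>) mod ?p)"
  define T where "T = Sigma {0..<?p} (\<lambda>i. {j\<in>{0..<?p}. (j * j) mod ?p = g i})"
  have gl: "g i < ?p" for i unfolding g_def by (rule mod_less_divisor) simp
  have "{(u, w). w^2 = u^3 + a * u + b} \<subseteq> (\<lambda>(i, j). (of_nat i, of_nat j)) ` T"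
  proof clarify
    fix u w :: "'p mod_ring"
    assume e: "w^2 = u^3 + a * u + b"
    obtain i where i: "i < ?p" "u = of_nat i" using surj_of_nat_mod_ring by blast
    obtain j where j: "j < ?p" "w = of_nat j" using surj_of_nat_mod_ring by blast
    have "(of_nat (j * j) :: 'p mod_ring) = of_nat (i * i * i + \<alpha> * i + \<beta>)"
      using e by (simp add: i j \<alpha> \<beta> power2_eq_square power3_eq_cube)
    hence "(j * j) mod ?p = (i * i * i + \<alpha> * i + \<beta>) mod ?p"
      by (simp only: of_nat_eq_iff_cong_CHAR cong_def semiring_char_mod_ring)
    hence "(i, j) \<in> T" using i j by (simp add: T_def g_def)
    thus "(u, w) \<in> (\<lambda>(i, j). (of_nat i, of_nat j)) ` T" using i j by force
  qed
  hence "card {(u, w). w^2 = u^3 + a * u + b} \<le> card T"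
    by (rule surj_card_le[rotated]) (simp add: T_def)
  also have "card T = (\<Sum>i\<in>{0..<?p}. card {j\<in>{0..<?p}. (j * j) mod ?p = g i})"
    unfolding T_def by (rule card_SigmaI) auto
  also have "\<dots> = (\<Sum>i\<in>{0..<?p}. square_root_counts ?p ! g i)"
  proof (rule sum.cong[OF refl])
    fix i
    have "{j\<in>{0..<?p}. (j * j) mod ?p = g i} = set (filter (\<lambda>j. (j * j) mod ?p = g i) [0..<?p])"
      by auto
    then show "card {j\<in>{0..<?p}. (j * j) mod ?p = g i} = square_root_counts ?p ! g i"
      using gl[of i] by (simp add: square_root_counts_def distinct_card del: set_filter)
  qed
  also have "\<dots> = sum_list (map (\<lambda>i. square_root_counts ?p ! g i) [0..<?p])"
    by (simp add: sum_list_distinct_conv_sum_set)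
  also have "\<dots> \<le> B"
    using assms \<alpha> \<beta> by (auto simp: cubic_counts_le_def list_all_iff g_def)
  finally show ?thesis .
qed

lemma cubic_counts_7: "cubic_counts_le 7 (square_root_counts 7) 13"
proof -
  have r: "square_root_counts 7 = [1,2,2,0,2,0,0]" by code_simp
  have u: "[0..<7] = [0,1,2,3,4,5,6]" by (simp add: upt_rec)
  show ?thesis unfolding cubic_counts_le_def r u by simp
qed

lemma cubic_counts_11: "cubic_counts_le 11 (square_root_counts 11) 18"
proof -
  have r: "square_root_counts 11 = [1,2,0,2,2,2,0,0,0,2,0]" by code_simp
  have u: "[0..<11] = [0,1,2,3,4,5,6,7,8,9,10]" by (simp add: upt_rec)
  show ?thesis unfolding cubic_counts_le_def r u by simp
qed

lemma cubic_counts_13: "cubic_counts_le 13 (square_root_counts 13) 20"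
proof -
  have r: "square_root_counts 13 = [1,2,0,2,2,0,0,0,0,2,2,0,2]" by code_simp
  have u: "[0..<13] = [0,1,2,3,4,5,6,7,8,9,10,11,12]" by (simp add: upt_rec)
  show ?thesis unfolding cubic_counts_le_def r u by simp
qed

text \<open>On \<open>w\<^sup>2 = s\<^sup>4 + e\<^sub>2 s\<^sup>2 + e\<^sub>1 s + e\<^sub>0\<close> the function \<open>\<sigma> = w - s\<^sup>2\<close> satisfies
  \<open>(2\<sigma> - e\<^sub>2) s\<^sup>2 - e\<^sub>1 s + \<sigma>\<^sup>2 - e\<^sub>0 = 0\<close>; the discriminant of this quadratic in \<open>s\<close> is a cubic in \<open>\<sigma>\<close>.\<close>

lemma card_quartic_curve_less:
  fixes e0 e1 e2 :: "'a::{field,finite}"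
  assumes two: "(2::'a) \<noteq> 0" and ns: "\<not> (e1 = 0 \<and> e0 = (e2 / 2)^2)"
  shows "card {(s, w). w^2 = s^4 + e2 * s^2 + e1 * s + e0}
       < card {(\<sigma>, y). y^2 = e1^2 - 4 * (2 * \<sigma> - e2) * (\<sigma>^2 - e0)}" (is "card ?S < card ?T")
proof -
  \<comment> \<open>The second component is the derivative in \<open>s\<close> of the quadratic in
    \<open>s\<close> that \<open>\<sigma>\<close> yields, so its square is the discriminant.\<close>
  define h where "h = (\<lambda>(s, w). (w - s^2, 2 * (2 * (w - s^2) - e2) * s - e1))"
  have eq: "(2 * (w - s^2) - e2) * s^2 - e1 * s + ((w - s^2)^2 - e0) = 0" if "(s, w) \<in> ?S" for s w
    using that by (simp add: power2_eq_square power4_eq_xxxx algebra_simps)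
  have im: "h ` ?S \<subseteq> ?T"
  proof
    fix x assume "x \<in> h ` ?S"
    then obtain s w a b where a: "(s, w) \<in> ?S" and h: "h (s, w) = (a, b)" and x: "x = (a, b)"
      by (metis (no_types, lifting) imageE surj_pair)
    have b: "b = 2 * (2 * a - e2) * s - e1" using h by (auto simp: h_def)
    have "b^2 - (e1^2 - 4 * (2 * a - e2) * (a^2 - e0))
        = 4 * (2 * a - e2) * ((2 * a - e2) * s^2 - e1 * s + (a^2 - e0))"
      unfolding b by (simp add: power2_eq_square algebra_simps)
    also have "\<dots> = 0" using eq[OF a] h by (auto simp: h_def)
    finally show "x \<in> ?T" by (simp add: x)
  qed
  \<comment> \<open>At \<open>\<sigma> = e2 / 2\<close> the leading coefficient of the quadratic
    vanishes and a linear equation for \<open>s\<close> remains. By \<open>ns\<close> it still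
    determines \<open>s\<close>.\<close>
  have lin: "e1 * s = (e2 / 2)^2 - e0" if "(s, w) \<in> ?S" "2 * (w - s^2) = e2" for s w
  proof -
    have "w - s^2 = e2 / 2" using that(2) two by (metis nonzero_mult_div_cancel_left)
    with eq[OF that(1)] that(2) show ?thesis by (simp add: algebra_simps)
  qed
  have inj: "inj_on h ?S"
  proof (rule inj_onI)
    fix x x' assume "x \<in> ?S" "x' \<in> ?S" and hx: "h x = h x'"
    then obtain s w s' w' where x: "x = (s, w)" "x' = (s', w')"
      and 1: "(s, w) \<in> ?S" and 2: "(s', w') \<in> ?S" by (metis surj_pair)
    have h: "h (s, w) = h (s', w')" using hx by (simp add: x)
    have e: "w - s^2 = w' - s'^2" using h by (simp add: h_def)
    have "s = s'"
    proof (cases "2 * (w - s^2) = e2")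
      case False
      then have "2 * (2 * (w - s^2) - e2) \<noteq> 0" using two by (simp del: right_diff_distrib_numeral)
      moreover have "2 * (2 * (w - s^2) - e2) * s = 2 * (2 * (w - s^2) - e2) * s'"
        using h unfolding h_def prod.case prod.inject e[symmetric] by (simp only: diff_left_imp_eq add_left_cancel diff_conv_add_uminus add_right_cancel)
      ultimately show ?thesis by (rule mult_left_cancel[THEN iffD1])
    next
      case True
      from lin[OF 1 True] lin[OF 2] True e have "e1 * s = e1 * s'" by simp
      moreover have "e1 \<noteq> 0" using lin[OF 1 True] ns by auto
      ultimately show ?thesis by simp
    qed
    with e show "x = x'" by (simp add: x)
  qed
  \<comment> \<open>This point makes the inequality strict. On the image,
    \<open>\<sigma> = e2 / 2\<close> forces the second component \<open>- e1\<close>, so hitting the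
    point would give \<open>e1 = 0\<close>, and then \<open>e0 = (e2 / 2)^2\<close>.\<close>
  have "(e2 / 2, e1) \<in> ?T" using two by simp
  moreover have "(e2 / 2, e1) \<notin> h ` ?S"
  proof
    assume "(e2 / 2, e1) \<in> h ` ?S"
    then obtain s w where 1: "(s, w) \<in> ?S" and h: "h (s, w) = (e2 / 2, e1)" by auto
    have "w - s^2 = e2 / 2" using h unfolding h_def by (simp only: prod.case prod.inject)
    hence t: "2 * (w - s^2) = e2"
      by (simp only: times_divide_eq_right nonzero_mult_div_cancel_left[OF two])
    have "2 * (2 * (w - s^2) - e2) * s - e1 = e1"
      using h unfolding h_def prod.case prod.inject by (rule conjunct2)
    hence "- e1 = e1" unfolding t by simp
    hence "2 * e1 = 0" by (metis add.right_inverse mult_2)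
    hence "e1 = 0" using two by simp
    with lin[OF 1 t] ns show False by simp
  qed
  ultimately have "h ` ?S \<subset> ?T" using im by blast
  hence "card (h ` ?S) < card ?T" by (intro psubset_card_mono) auto
  thus ?thesis using inj by (simp add: card_image)
qed

section \<open>Reduction of double covers of the line to cubics in normal form\<close>

lemma card_eq_by_bij:
  assumes "\<And>x. x \<in> A \<Longrightarrow> f x \<in> B" "\<And>y. y \<in> B \<Longrightarrow> g y \<in> A"
    "\<And>x. x \<in> A \<Longrightarrow> g (f x) = x" "\<And>y. y \<in> B \<Longrightarrow> f (g y) = y"
  shows "card A = card B"
  by (rule bij_betw_same_card[of f], rule bij_betwI[where g = g]) (use assms in auto)

text \<open>Multiplying by \<open>d\<^sub>3\<^sup>2\<close> makes the cubic monic in \<open>d\<^sub>3 u\<close>; a shift removes the square term.\<close>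

lemma card_cubic_curve_normalise:
  fixes d0 d1 d2 d3 :: "'a::{field,finite}"
  assumes three: "(3::'a) \<noteq> 0" and d3: "d3 \<noteq> 0"
  shows "\<exists>a b::'a. card {(u, w). w^2 = d3 * u^3 + d2 * u^2 + d1 * u + d0}
      = card {(u, w). w^2 = u^3 + a * u + b}"
proof -
  define m where "m = d2 / 3"
  have d2: "d2 = 3 * m" using three by (simp add: m_def)
  define a where "a = d1 * d3 - 3 * m^2"
  define b where "b = d0 * d3^2 - m^3 - a * m"
  have key: "d3^2 * (d3 * u^3 + d2 * u^2 + d1 * u + d0) = (d3 * u + m)^3 + a * (d3 * u + m) + b" for u
    by (simp add: d2 a_def b_def power2_eq_square power3_eq_cube algebra_simps)
  have "card {(u, w). w^2 = d3 * u^3 + d2 * u^2 + d1 * u + d0} = card {(u, w). w^2 = u^3 + a * u + b}"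
  proof (rule card_eq_by_bij[where f = "\<lambda>(u, w). (d3 * u + m, d3 * w)" and g = "\<lambda>(u, w). ((u - m) / d3, w / d3)"])
    fix y assume "y \<in> {(u, w). w^2 = u^3 + a * u + b}"
    then obtain u w where y: "y = (u, w)" and e: "w^2 = u^3 + a * u + b" by auto
    have "d3^2 * (d3 * ((u - m) / d3)^3 + d2 * ((u - m) / d3)^2 + d1 * ((u - m) / d3) + d0) = w^2"
      unfolding key e using d3 by simp
    also have "w^2 = d3^2 * (w / d3)^2" using d3 by (simp add: power_divide)
    finally show "(case y of (u, w) \<Rightarrow> ((u - m) / d3, w / d3)) \<in> {(u, w). w^2 = d3 * u^3 + d2 * u^2 + d1 * u + d0}"
      using d3 y by simp
  qed (use d3 in \<open>auto simp flip: key simp: power_mult_distrib\<close>)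
  thus ?thesis by blast
qed

text \<open>Completing the square in \<open>z\<close> leaves \<open>w^2 = D(u)\<close> with
  \<open>D = b^2 - 4 c\<close>. For \<open>b0 = 0\<close> this \<open>D\<close> is a cubic with
  leading coefficient \<open>-4 c0\<close>; otherwise it is a quartic with leading coefficient
  \<open>b0^2\<close>, and the strict bound fails only if \<open>D\<close> is a square. The equation
  for \<open>c0\<close> compares the coefficients of \<open>u^3\<close>; it settles the line
  \<open>y = 0\<close> in \<open>cub_factor\<close>.\<close>

lemma conic_bundle_count:
  fixes b0 b1 b2 c0 c1 c2 c3 :: "'a::{field,finite}"
  defines "M \<equiv> card {(u, z). z^2 + (b0 * u^2 + b1 * u + b2) * z + (c0 * u^3 + c1 * u^2 + c2 * u + c3) = 0}"
  assumes two: "(2::'a) \<noteq> 0" and three: "(3::'a) \<noteq> 0"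
    and bound: "\<And>a b::'a. card {(u, w). w^2 = u^3 + a * u + b} \<le> B"
  shows "b0 = 0 \<Longrightarrow> c0 \<noteq> 0 \<Longrightarrow> M \<le> B"
    and "b0 \<noteq> 0 \<Longrightarrow> M < B \<or> (\<exists>g1 g2. 4 * c0 = 2 * b0 * (b1 - g1) \<and>
          (\<forall>u. (b0 * u^2 + b1 * u + b2)^2 - 4 * (c0 * u^3 + c1 * u^2 + c2 * u + c3) = (b0 * u^2 + g1 * u + g2)^2))"
proof -
  let ?b = "\<lambda>u. b0 * u^2 + b1 * u + b2"
  let ?c = "\<lambda>u. c0 * u^3 + c1 * u^2 + c2 * u + c3"
  have four: "(4::'a) \<noteq> 0" using two by (metis mult_2_right mult_eq_0_iff numeral_Bit0)
  have eight: "(8::'a) \<noteq> 0"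
  proof -
    have "(8::'a) = 2 * 4" by simp
    thus ?thesis using two four by (metis mult_eq_0_iff)
  qed
  have disc: "(2 * z + ?b u)^2 = ?b u^2 - 4 * ?c u \<longleftrightarrow> z^2 + ?b u * z + ?c u = 0" for u z
  proof -
    have "(2 * z + ?b u)^2 - (?b u^2 - 4 * ?c u) = 4 * (z^2 + ?b u * z + ?c u)"
      by (simp add: power2_eq_square algebra_simps)
    thus ?thesis using four by (metis eq_iff_diff_eq_0 mult_eq_0_iff)
  qed
  have M: "M = card {(u, w). w^2 = ?b u^2 - 4 * ?c u}" unfolding M_def
  proof (rule card_eq_by_bij[where f = "\<lambda>(u, z). (u, 2 * z + ?b u)" and g = "\<lambda>(u, w). (u, (w - ?b u) / 2)"])
    fix y assume "y \<in> {(u, w). w^2 = ?b u^2 - 4 * ?c u}"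
    then obtain u w where y: "y = (u, w)" and e: "w^2 = ?b u^2 - 4 * ?c u" by auto
    have "2 * ((w - ?b u) / 2) + ?b u = w"
      unfolding times_divide_eq_right nonzero_mult_div_cancel_left[OF two] by (rule diff_add_cancel)
    hence "(2 * ((w - ?b u) / 2) + ?b u)^2 = ?b u^2 - 4 * ?c u" using e by (simp only:)
    thus "(case y of (u, w) \<Rightarrow> (u, (w - ?b u) / 2)) \<in> {(u, z). z^2 + ?b u * z + ?c u = 0}"
      unfolding disc using y by simp
  next
    fix y assume "y \<in> {(u, w). w^2 = ?b u^2 - 4 * ?c u}"
    show "(case case y of (u, w) \<Rightarrow> (u, (w - ?b u) / 2) of (u, z) \<Rightarrow> (u, 2 * z + ?b u)) = y"
      unfolding case_prod_beta fst_conv snd_conv times_divide_eq_right nonzero_mult_div_cancel_left[OF two] by simp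
  qed (use two disc in auto)
  have cub: "card {(u, w). w^2 = d3 * u^3 + d2 * u^2 + d1 * u + d0} \<le> B" if "d3 \<noteq> 0" for d0 d1 d2 d3 :: 'a
    using card_cubic_curve_normalise[OF three that, of d2 d1 d0] bound by metis
  show "M \<le> B" if "b0 = 0" "c0 \<noteq> 0"
  proof -
    have D: "?b u^2 - 4 * ?c u = (-4 * c0) * u^3 + (b1^2 - 4 * c1) * u^2 + (2 * b1 * b2 - 4 * c2) * u + (b2^2 - 4 * c3)" for u
      using that by (simp add: power2_eq_square power3_eq_cube algebra_simps)
    show ?thesis unfolding M D by (rule cub) (use four that in simp)
  qed
  show "M < B \<or> (\<exists>g1 g2. 4 * c0 = 2 * b0 * (b1 - g1) \<and> (\<forall>u. ?b u^2 - 4 * ?c u = (b0 * u^2 + g1 * u + g2)^2))" if b0: "b0 \<noteq> 0"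
  proof -
    \<comment> \<open>Division by \<open>b0^2\<close> makes the quartic monic, and the shift by
      \<open>m\<close> removes its cubic term; \<open>e2\<close>, \<open>e1\<close>,
      \<open>e0\<close> are then read off by comparing coefficients.\<close>
    define m where "m = (2 * b0 * b1 - 4 * c0) / (4 * b0^2)"
    define e2 where "e2 = (b1^2 + 2 * b0 * b2 - 4 * c1) / b0^2 - 6 * m^2"
    define e1 where "e1 = (2 * b1 * b2 - 4 * c2) / b0^2 - 4 * m^3 - 2 * m * e2"
    define e0 where "e0 = (b2^2 - 4 * c3) / b0^2 - m^4 - m^2 * e2 - m * e1"
    have m3: "2 * b0 * b1 - 4 * c0 = 4 * b0^2 * m" using b0 four by (simp add: m_def)
    have m2: "b1^2 + 2 * b0 * b2 - 4 * c1 = b0^2 * (6 * m^2 + e2)" using b0 by (simp add: e2_def)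
    have m1: "2 * b1 * b2 - 4 * c2 = b0^2 * (4 * m^3 + 2 * m * e2 + e1)" using b0 by (simp add: e1_def)
    have m0: "b2^2 - 4 * c3 = b0^2 * (m^4 + m^2 * e2 + m * e1 + e0)" using b0 by (simp add: e0_def)
    have D: "?b u^2 - 4 * ?c u = b0^2 * ((u + m)^4 + e2 * (u + m)^2 + e1 * (u + m) + e0)" for u
    proof -
      have "?b u^2 - 4 * ?c u = b0^2 * u^4 + (2 * b0 * b1 - 4 * c0) * u^3 + (b1^2 + 2 * b0 * b2 - 4 * c1) * u^2
            + (2 * b1 * b2 - 4 * c2) * u + (b2^2 - 4 * c3)"
        by (simp add: power2_eq_square power3_eq_cube power4_eq_xxxx algebra_simps)
      also have "\<dots> = b0^2 * ((u + m)^4 + e2 * (u + m)^2 + e1 * (u + m) + e0)"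
        unfolding m3 m2 m1 m0 by (simp add: power2_eq_square power3_eq_cube power4_eq_xxxx algebra_simps)
      finally show ?thesis .
    qed
    show ?thesis
    proof (cases "e1 = 0 \<and> e0 = (e2 / 2)^2")
      case True
      define h where "h = e2 / 2"
      have e2: "e2 = 2 * h" using two by (simp add: h_def)
      have "?b u^2 - 4 * ?c u = (b0 * u^2 + (2 * b0 * m) * u + (b0 * (m^2 + h)))^2" for u
        unfolding D using True two unfolding h_def[symmetric] e2
        by (simp add: power2_eq_square power4_eq_xxxx algebra_simps)
      moreover have "4 * c0 = 2 * b0 * (b1 - 2 * b0 * m)"
        using m3 by (simp add: power2_eq_square algebra_simps)
      ultimately show ?thesis by blast
    next
      case False
      have "M = card {(s, w). w^2 = s^4 + e2 * s^2 + e1 * s + e0}" unfolding M D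
      proof (rule card_eq_by_bij[where f = "\<lambda>(u, w). (u + m, w / b0)" and g = "\<lambda>(s, w). (s - m, b0 * w)"])
      qed (use b0 in \<open>auto simp: power_mult_distrib power_divide field_simps\<close>)
      also have "\<dots> < card {(\<sigma>, y). y^2 = e1^2 - 4 * (2 * \<sigma> - e2) * (\<sigma>^2 - e0)}"
        by (rule card_quartic_curve_less[OF two False])
      also have "\<dots> = card {(\<sigma>, y). y^2 = (-8) * \<sigma>^3 + (4 * e2) * \<sigma>^2 + (8 * e0) * \<sigma> + (e1^2 - 4 * e2 * e0)}"
        by (simp add: power2_eq_square power3_eq_cube algebra_simps)
      also have "\<dots> \<le> B" by (rule cub) (use eight in simp)
      finally show ?thesis by simp
    qed
  qed
qed

text \<open>Ternary cubic forms vanishing at \<open>(0, 0, 1)\<close>.\<close>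

definition cub :: "'a::field \<Rightarrow> 'a \<Rightarrow> 'a \<Rightarrow> 'a \<Rightarrow> 'a \<Rightarrow> 'a \<Rightarrow> 'a \<Rightarrow> 'a \<Rightarrow> 'a \<Rightarrow> 'a \<Rightarrow> 'a \<Rightarrow> 'a \<Rightarrow> 'a" where
  "cub \<alpha> \<beta> b0 b1 b2 c0 c1 c2 c3 x y z = (\<alpha> * x + \<beta> * y) * z^2
     + (b0 * x^2 + b1 * x * y + b2 * y^2) * z + (c0 * x^3 + c1 * x^2 * y + c2 * x * y^2 + c3 * y^3)"

section \<open>Lines contained in plane cubics\<close>

definition linear_form :: "('a::field \<Rightarrow> 'a \<Rightarrow> 'a \<Rightarrow> 'a) \<Rightarrow> bool" where
  "linear_form l \<longleftrightarrow> (\<exists>p q r. \<forall>x y z. l x y z = p * x + q * y + r * z)"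

definition quadratic_form :: "('a::field \<Rightarrow> 'a \<Rightarrow> 'a \<Rightarrow> 'a) \<Rightarrow> bool" where
  "quadratic_form g \<longleftrightarrow> (\<exists>p q r s t v. \<forall>x y z.
     g x y z = p * x^2 + q * x * y + r * y^2 + s * x * z + t * y * z + v * z^2)"

text \<open>The factorisation concerns values at all vectors of the field, not coefficients. The
  factors may be zero, so the zero function qualifies; nonvanishing is argued separately.\<close>

definition contains_line :: "('a::field \<Rightarrow> 'a \<Rightarrow> 'a \<Rightarrow> 'a) \<Rightarrow> bool" where
  "contains_line f \<longleftrightarrow> (\<exists>l g. linear_form l \<and> quadratic_form g \<and> (\<forall>x y z. f x y z = l x y z * g x y z))"

definition zeros :: "('a \<Rightarrow> 'a \<Rightarrow> 'a \<Rightarrow> 'a::field) \<Rightarrow> ('a \<times> 'a \<times> 'a) set" where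
  "zeros f = {(x, y, z). f x y z = 0}"

lemma linear_formI: "(\<And>x y z. l x y z = p * x + q * y + r * z) \<Longrightarrow> linear_form l"
  unfolding linear_form_def by blast

lemma quadratic_formI:
  "(\<And>x y z. g x y z = p * x^2 + q * x * y + r * y^2 + s * x * z + t * y * z + v * z^2) \<Longrightarrow> quadratic_form g"
  unfolding quadratic_form_def by blast

lemma contains_lineI:
  "linear_form l \<Longrightarrow> quadratic_form g \<Longrightarrow> (\<And>x y z. f x y z = l x y z * g x y z) \<Longrightarrow> contains_line f"
  unfolding contains_line_def by blast

lemma contains_line_scale:
  assumes "contains_line g" "\<And>x y z. f x y z = k * g x y z"
  shows "contains_line f"
proof -
  obtain l h where l: "linear_form l" and h: "quadratic_form h" and g: "\<And>x y z. g x y z = l x y z * h x y z"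
    using assms(1) unfolding contains_line_def by blast
  obtain p q r where "\<And>x y z. l x y z = p * x + q * y + r * z" using l unfolding linear_form_def by blast
  then have "linear_form (\<lambda>x y z. k * l x y z)"
    by (intro linear_formI[of _ "k * p" "k * q" "k * r"]) (simp add: algebra_simps)
  thus ?thesis using h by (rule contains_lineI) (simp add: assms(2) g)
qed

lemma contains_line_subst:
  assumes "contains_line g" "\<And>x y z. f x y z = g y (x + k * y) z"
  shows "contains_line f"
proof -
  obtain l h where l: "linear_form l" and h: "quadratic_form h" and g: "\<And>x y z. g x y z = l x y z * h x y z"
    using assms(1) unfolding contains_line_def by blast
  obtain p q r where L: "\<And>x y z. l x y z = p * x + q * y + r * z" using l unfolding linear_form_def by blast
  have l': "linear_form (\<lambda>x y z. l y (x + k * y) z)"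
    by (intro linear_formI[of _ q "p + k * q" r]) (simp add: L algebra_simps)
  obtain p q r s t v where Q: "\<And>x y z. h x y z = p * x^2 + q * x * y + r * y^2 + s * x * z + t * y * z + v * z^2"
    using h unfolding quadratic_form_def by blast
  have "quadratic_form (\<lambda>x y z. h y (x + k * y) z)"
    by (intro quadratic_formI[of _ r "q + 2 * r * k" "p + q * k + r * k^2" t "s + t * k" v])
      (simp add: Q power2_eq_square algebra_simps)
  with l' show ?thesis by (rule contains_lineI) (simp add: assms(2) g)
qed

lemma cub_scale:
  "cub (k * \<alpha>) (k * \<beta>) (k * b0) (k * b1) (k * b2) (k * c0) (k * c1) (k * c2) (k * c3) x y z
   = k * cub \<alpha> \<beta> b0 b1 b2 c0 c1 c2 c3 x y z"
  by (simp add: cub_def algebra_simps)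

lemma cub_homogeneous:
  "cub \<alpha> \<beta> b0 b1 b2 c0 c1 c2 c3 (k * x) (k * y) (k * z) = k^3 * cub \<alpha> \<beta> b0 b1 b2 c0 c1 c2 c3 x y z"
  by (simp add: cub_def power2_eq_square power3_eq_cube algebra_simps)

text \<open>Each remaining monomial is divisible by \<open>y\<close>.\<close>

lemma cub_contains_line_at_infinity: "contains_line (cub 0 \<beta> 0 b1 b2 0 c1 c2 c3)"
  by (rule contains_lineI[of "\<lambda>x y z. y" "\<lambda>x y z. c1 * x^2 + c2 * x * y + c3 * y^2 + b1 * x * z + b2 * y * z + \<beta> * z^2"])
    (auto simp: cub_def power2_eq_square power3_eq_cube algebra_simps
      intro!: linear_formI[of _ 0 1 0] quadratic_formI[of _ c1 c2 c3 b1 b2 \<beta>])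

text \<open>With \<open>b\<close>, \<open>c\<close>, \<open>g\<close> the polynomials in
  \<open>u\<close> and \<open>y = 1\<close>, the form times 4 is
  \<open>(2 z + b)^2 - g^2 = (2 z + b - g) (2 z + b + g)\<close>. The leading terms of
  \<open>b\<close> and \<open>g\<close> agree, so \<open>b - g\<close> has degree at most 1 and the
  first factor is linear.\<close>

lemma cub_factor:
  assumes "(2::'a::field) \<noteq> 0" "4 * c0 = 2 * b0 * (b1 - g1)"
    and D: "\<And>u::'a. (b0 * u^2 + b1 * u + b2)^2 - 4 * (c0 * u^3 + c1 * u^2 + c2 * u + c3) = (b0 * u^2 + g1 * u + g2)^2"
  shows "contains_line (cub 0 1 b0 b1 b2 c0 c1 c2 c3)"
proof -
  let ?l = "\<lambda>x y z. 2 * z + (b1 - g1) * x + (b2 - g2) * y"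
  let ?g = "\<lambda>x y z. 2 * y * z + 2 * b0 * x^2 + (b1 + g1) * x * y + (b2 + g2) * y^2"
  have l: "linear_form (\<lambda>x y z. ?l x y z / 4)"
    by (intro linear_formI[of _ "(b1 - g1) / 4" "(b2 - g2) / 4" "2 / 4"]) (simp add: add_divide_distrib)
  have g: "quadratic_form ?g"
    by (intro quadratic_formI[of _ "2 * b0" "b1 + g1" "b2 + g2" 0 2 0]) simp
  have four: "(4::'a) \<noteq> 0" using assms(1) by (metis mult_2_right mult_eq_0_iff numeral_Bit0)
  have *: "4 * cub 0 1 b0 b1 b2 c0 c1 c2 c3 x y z = ?l x y z * ?g x y z" for x y z
  \<comment> \<open>The identity for \<open>D\<close> is only about \<open>u = x / y\<close>; on the
    line \<open>y = 0\<close> the equation for \<open>c0\<close> takes its place.\<close>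
  proof (cases "y = 0")
    case True
    have "4 * cub 0 1 b0 b1 b2 c0 c1 c2 c3 x 0 z = 4 * b0 * x^2 * z + (4 * c0) * x^3"
      by (simp add: cub_def power2_eq_square power3_eq_cube algebra_simps)
    also have "\<dots> = ?l x 0 z * ?g x 0 z"
      unfolding assms(2) by (simp add: power2_eq_square power3_eq_cube algebra_simps)
    finally show ?thesis using True by simp
  next
    case False
    define u where "u = x / y"
    define w where "w = z / y"
    have x: "x = u * y" and z: "z = w * y" using False by (auto simp: u_def w_def)
    have "4 * cub 0 1 b0 b1 b2 c0 c1 c2 c3 x y z = y^3 * ((2 * w + (b0 * u^2 + b1 * u + b2))^2
        - ((b0 * u^2 + b1 * u + b2)^2 - 4 * (c0 * u^3 + c1 * u^2 + c2 * u + c3)))"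
      unfolding x z by (simp add: cub_def power2_eq_square power3_eq_cube algebra_simps)
    also have "\<dots> = ?l x y z * ?g x y z"
      unfolding D x z by (simp add: power2_eq_square power3_eq_cube algebra_simps)
    finally show ?thesis .
  qed
  show ?thesis
  proof (rule contains_lineI[OF l g])
    fix x y z
    have "cub 0 1 b0 b1 b2 c0 c1 c2 c3 x y z = (?l x y z * ?g x y z) / 4"
      unfolding *[symmetric] using four by simp
    thus "cub 0 1 b0 b1 b2 c0 c1 c2 c3 x y z = ?l x y z / 4 * ?g x y z" by simp
  qed
qed

text \<open>The bound equals \<open>1 + (q - 1) (B + 1)\<close>: the zero vector and the multiples
  of \<open>B + 1\<close> points. The zeros split into the axis \<open>x = y = 0\<close>, the rest
  of the line \<open>y = 0\<close>, and the nonzero multiples of the affine points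
  \<open>A\<close>.\<close>

lemma card_zeros_cub_normal:
  fixes b0 b1 b2 c0 c1 c2 c3 :: "'a::{field,finite}"
  assumes two: "(2::'a) \<noteq> 0" and three: "(3::'a) \<noteq> 0"
    and bound: "\<And>a b::'a. card {(u, w). w^2 = u^3 + a * u + b} \<le> B"
    and nl: "\<not> contains_line (cub 0 1 b0 b1 b2 c0 c1 c2 c3)"
  shows "card (zeros (cub 0 1 b0 b1 b2 c0 c1 c2 c3)) \<le> CARD('a) + (CARD('a) - 1) * B"
proof -
  let ?f = "cub 0 1 b0 b1 b2 c0 c1 c2 c3"
  let ?q = "CARD('a)"
  define A where "A = {(u, z). z^2 + (b0 * u^2 + b1 * u + b2) * z + (c0 * u^3 + c1 * u^2 + c2 * u + c3) = 0}"
  define Z0 :: "('a \<times> 'a \<times> 'a) set" where "Z0 = (\<lambda>z. (0, 0, z)) ` UNIV"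
  define Z1 where "Z1 = {(x, y, z). x \<noteq> 0 \<and> y = 0 \<and> ?f x y z = 0}"
  define Z2 where "Z2 = (\<lambda>(y, u, z). (u * y, y, z * y)) ` ((UNIV - {0}) \<times> A)"
  have "zeros ?f \<subseteq> Z0 \<union> Z1 \<union> Z2"
  proof
    fix v assume v: "v \<in> zeros ?f"
    obtain x y z where v': "v = (x, y, z)" by (metis prod_cases3)
    with v have f: "?f x y z = 0" by (simp add: zeros_def)
    show "v \<in> Z0 \<union> Z1 \<union> Z2"
    proof (cases "y = 0")
      case True
      with f show ?thesis by (auto simp: v' Z0_def Z1_def)
    next
      case False
      define u where "u = x / y"
      define w where "w = z / y"
      have x: "x = u * y" and z: "z = w * y" using False by (auto simp: u_def w_def)
      have "?f x y z = y^3 * (w^2 + (b0 * u^2 + b1 * u + b2) * w + (c0 * u^3 + c1 * u^2 + c2 * u + c3))"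
        unfolding x z by (simp add: cub_def power2_eq_square power3_eq_cube algebra_simps)
      with f False have "(u, w) \<in> A" by (simp add: A_def)
      with False have "(\<lambda>(y, u, z). (u * y, y, z * y)) (y, u, w) \<in> Z2" unfolding Z2_def by blast
      thus ?thesis by (simp add: v' x z)
    qed
  qed
  hence "card (zeros ?f) \<le> card (Z0 \<union> Z1 \<union> Z2)" by (intro card_mono) auto
  also have "\<dots> \<le> card Z0 + card Z1 + card Z2"
    by (meson add_le_mono1 card_Un_le order_trans)
  finally have 1: "card (zeros ?f) \<le> card Z0 + card Z1 + card Z2" .
  have Z0: "card Z0 = ?q" unfolding Z0_def by (subst card_image) (auto intro: inj_onI)
  have "card Z2 \<le> card ((UNIV - {0::'a}) \<times> A)" unfolding Z2_def by (rule card_image_le) auto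
  also have "\<dots> = (?q - 1) * card A" by (simp add: card_cartesian_product card_Diff_singleton)
  finally have Z2: "card Z2 \<le> (?q - 1) * card A" .
  have f0: "?f x 0 z = x^2 * (b0 * z + c0 * x)" for x z
    by (simp add: cub_def power2_eq_square power3_eq_cube algebra_simps)
  show ?thesis
  proof (cases "b0 = 0")
    case True
    have c0: "c0 \<noteq> 0" using nl True cub_contains_line_at_infinity by metis
    have "Z1 = {}"
    proof (rule equals0I)
      fix v assume "v \<in> Z1"
      then obtain x z where "x \<noteq> 0" "?f x 0 z = 0" by (auto simp: Z1_def)
      with True c0 f0[of x z] show False by simp
    qed
    hence "card Z1 = 0" by simp
    moreover have "card A \<le> B" unfolding A_def
      by (rule conic_bundle_count(1)[OF two three bound True c0])
    hence "(?q - 1) * card A \<le> (?q - 1) * B" by simp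
    ultimately show ?thesis using 1 Z0 Z2 by linarith
  next
    case False
    have "card A < B"
    proof (rule ccontr)
      assume "\<not> card A < B"
      then obtain g1 g2 where "4 * c0 = 2 * b0 * (b1 - g1)"
        "\<And>u. (b0 * u^2 + b1 * u + b2)^2 - 4 * (c0 * u^3 + c1 * u^2 + c2 * u + c3) = (b0 * u^2 + g1 * u + g2)^2"
        using conic_bundle_count(2)[OF two three bound False, of b1 b2 c0 c1 c2 c3] unfolding A_def by blast
      from cub_factor[OF two this] nl show False by simp
    qed
    \<comment> \<open>The strict bound on \<open>A\<close> leaves room for the one further point on
      the line \<open>y = 0\<close>.\<close>
    hence "(?q - 1) * Suc (card A) \<le> (?q - 1) * B" by (intro mult_le_mono) auto
    moreover have "Z1 \<subseteq> (\<lambda>x. (x, 0, - c0 * x / b0)) ` (UNIV - {0})"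
    proof clarify
      fix x y z assume "(x, y, z) \<in> Z1"
      hence "x \<noteq> 0" "y = 0" "b0 * z + c0 * x = 0" by (auto simp: Z1_def f0)
      moreover from this have "z = - c0 * x / b0" using False
        by (simp add: nonzero_eq_divide_eq add_eq_0_iff mult.commute)
      ultimately show "(x, y, z) \<in> (\<lambda>x. (x, 0, - c0 * x / b0)) ` (UNIV - {0})" by auto
    qed
    hence "card Z1 \<le> card (UNIV - {0::'a})" by (rule surj_card_le[rotated]) simp
    hence "card Z1 \<le> ?q - 1" by (simp add: card_Diff_singleton)
    ultimately show ?thesis using 1 Z0 Z2 by simp
  qed
qed

lemma card_zeros_cub:
  fixes \<alpha> \<beta> b0 b1 b2 c0 c1 c2 c3 :: "'a::{field,finite}"
  assumes two: "(2::'a) \<noteq> 0" and three: "(3::'a) \<noteq> 0"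
    and bound: "\<And>a b::'a. card {(u, w). w^2 = u^3 + a * u + b} \<le> B"
    and nz: "\<alpha> \<noteq> 0 \<or> \<beta> \<noteq> 0"
    and nl: "\<not> contains_line (cub \<alpha> \<beta> b0 b1 b2 c0 c1 c2 c3)"
  shows "card (zeros (cub \<alpha> \<beta> b0 b1 b2 c0 c1 c2 c3)) \<le> CARD('a) + (CARD('a) - 1) * B"
proof (cases "\<alpha> = 0")
  case True
  with nz have b: "\<beta> \<noteq> 0" by simp
  let ?g = "cub 0 1 (b0/\<beta>) (b1/\<beta>) (b2/\<beta>) (c0/\<beta>) (c1/\<beta>) (c2/\<beta>) (c3/\<beta>)"
  have f: "cub \<alpha> \<beta> b0 b1 b2 c0 c1 c2 c3 x y z = \<beta> * ?g x y z" for x y z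
    unfolding cub_scale[symmetric] using b True by simp
  have "\<not> contains_line ?g" using nl contains_line_scale f by blast
  from card_zeros_cub_normal[OF two three bound this] show ?thesis
    using b by (simp add: zeros_def f)
next
  case False
  define k where "k = \<beta> / \<alpha>"
  have \<beta>: "\<beta> = \<alpha> * k" using False by (simp add: k_def)
  \<comment> \<open>The coefficients come from substituting \<open>x = Y - k X\<close>,
    \<open>y = X\<close>: this makes \<open>\<alpha> x + \<beta> y\<close> equal to
    \<open>\<alpha> Y\<close>, and dividing by \<open>\<alpha>\<close> normalises it.\<close>
  let ?g = "cub 0 1 ((b0 * k^2 - b1 * k + b2) / \<alpha>) ((b1 - 2 * b0 * k) / \<alpha>) (b0 / \<alpha>)
     ((- c0 * k^3 + c1 * k^2 - c2 * k + c3) / \<alpha>) ((3 * c0 * k^2 - 2 * c1 * k + c2) / \<alpha>) ((c1 - 3 * c0 * k) / \<alpha>) (c0 / \<alpha>)"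
  have f: "cub \<alpha> \<beta> b0 b1 b2 c0 c1 c2 c3 x y z = \<alpha> * ?g y (x + k * y) z" for x y z
  proof -
    have "\<alpha> * ?g y (x + k * y) z = cub 0 \<alpha> (b0 * k^2 - b1 * k + b2) (b1 - 2 * b0 * k) b0
      (- c0 * k^3 + c1 * k^2 - c2 * k + c3) (3 * c0 * k^2 - 2 * c1 * k + c2) (c1 - 3 * c0 * k) c0 y (x + k * y) z"
      unfolding cub_scale[symmetric] using False by simp
    also have "\<dots> = cub \<alpha> \<beta> b0 b1 b2 c0 c1 c2 c3 x y z"
    proof -
      have "(b0 * k^2 - b1 * k + b2) * y^2 + (b1 - 2 * b0 * k) * y * (x + k * y) + b0 * (x + k * y)^2
          = b0 * x^2 + b1 * x * y + b2 * y^2"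
        by (simp add: power2_eq_square algebra_simps)
      moreover have "(- c0 * k^3 + c1 * k^2 - c2 * k + c3) * y^3
          + (3 * c0 * k^2 - 2 * c1 * k + c2) * y^2 * (x + k * y) + (c1 - 3 * c0 * k) * y * (x + k * y)^2
          + c0 * (x + k * y)^3 = c0 * x^3 + c1 * x^2 * y + c2 * x * y^2 + c3 * y^3"
        by (simp add: power2_eq_square power3_eq_cube algebra_simps)
      moreover have "0 * y + \<alpha> * (x + k * y) = \<alpha> * x + \<beta> * y"
        by (simp add: \<beta> algebra_simps)
      ultimately show ?thesis unfolding cub_def by (simp only:)
    qed
    finally show ?thesis by simp
  qed
  have "\<not> contains_line ?g"
  proof
    assume "contains_line ?g"
    hence "contains_line (\<lambda>x y z. ?g y (x + k * y) z)" by (rule contains_line_subst) simp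
    hence "contains_line (cub \<alpha> \<beta> b0 b1 b2 c0 c1 c2 c3)" by (rule contains_line_scale) (rule f)
    with nl show False by simp
  qed
  note card_zeros_cub_normal[OF two three bound this]
  moreover have "card (zeros (cub \<alpha> \<beta> b0 b1 b2 c0 c1 c2 c3)) = card (zeros ?g)"
    by (rule card_eq_by_bij[where f = "\<lambda>(x, y, z). (y, x + k * y, z)" and g = "\<lambda>(x, y, z). (y - k * x, x, z)"])
      (use False in \<open>auto simp: zeros_def f\<close>)
  ultimately show ?thesis by simp
qed

section \<open>The pencil of cubics through eight points\<close>

lemma cub_combination:
  "cub (l * \<alpha> + m * \<alpha>') (l * \<beta> + m * \<beta>') (l * b0 + m * d0) (l * b1 + m * d1) (l * b2 + m * d2)
     (l * c0 + m * e0) (l * c1 + m * e1) (l * c2 + m * e2) (l * c3 + m * e3) x y z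
   = l * cub \<alpha> \<beta> b0 b1 b2 c0 c1 c2 c3 x y z + m * cub \<alpha>' \<beta>' d0 d1 d2 e0 e1 e2 e3 x y z"
  by (simp add: cub_def algebra_simps)

text \<open>Values at vectors with entries 0, 1, -1 already determine the coefficients in
  characteristic other than 2.\<close>

lemma cub_eq_zero_coeffs:
  fixes b0 :: "'a::field"
  assumes two: "(2::'a) \<noteq> 0" and z: "\<And>x y z. cub 0 0 b0 b1 b2 c0 c1 c2 c3 x y z = 0"
  shows "b0 = 0" "b1 = 0" "b2 = 0" "c0 = 0" "c1 = 0" "c2 = 0" "c3 = 0"
proof -
  show c0: "c0 = 0" using z[of 1 0 0] by (simp add: cub_def)
  show c3: "c3 = 0" using z[of 0 1 0] by (simp add: cub_def)
  have "c1 + c2 = 0" using z[of 1 1 0] c0 c3 by (simp add: cub_def)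
  moreover have c21: "c2 = c1" using z[of 1 "-1" 0] c0 c3 by (simp add: cub_def)
  ultimately have "2 * c1 = 0" by (simp only: mult_2)
  thus c1: "c1 = 0" using two by simp
  thus c2: "c2 = 0" using c21 by simp
  show b0: "b0 = 0" using z[of 1 0 1] c0 by (simp add: cub_def)
  show b2: "b2 = 0" using z[of 0 1 1] c3 by (simp add: cub_def)
  show "b1 = 0" using z[of 1 1 1] b0 b2 c0 c1 c2 c3 by (simp add: cub_def)
qed

lemma cub_nonzero:
  fixes \<alpha> :: "'a::field"
  assumes two: "(2::'a) \<noteq> 0" and ab: "\<alpha> \<noteq> 0 \<or> \<beta> \<noteq> 0"
  shows "\<exists>x y z. cub \<alpha> \<beta> b0 b1 b2 c0 c1 c2 c3 x y z \<noteq> 0"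
proof (rule ccontr)
  assume "\<not> ?thesis"
  hence z: "\<And>x y z. cub \<alpha> \<beta> b0 b1 b2 c0 c1 c2 c3 x y z = 0" by blast
  \<comment> \<open>The second difference in \<open>z\<close> isolates the coefficient of
    \<open>z^2\<close>.\<close>
  have "2 * (\<alpha> * x + \<beta> * y) = cub \<alpha> \<beta> b0 b1 b2 c0 c1 c2 c3 x y 1 + cub \<alpha> \<beta> b0 b1 b2 c0 c1 c2 c3 x y (-1)
      - 2 * cub \<alpha> \<beta> b0 b1 b2 c0 c1 c2 c3 x y 0" for x y
    by (simp add: cub_def algebra_simps)
  hence "2 * (\<alpha> * x + \<beta> * y) = 0" for x y by (simp only: z) simp
  hence "\<alpha> * x + \<beta> * y = 0" for x y using two mult_eq_0_iff by blast
  from this[of 1 0] this[of 0 1] ab show False by simp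
qed

text \<open>The assumptions say that all coefficients of powers of \<open>z\<close> vanish at
  \<open>x = t\<close>, \<open>y = 1\<close>; hence each is divisible by \<open>x - t y\<close>, and
  the quadratic factor collects the quotients.\<close>

lemma cub_contains_line_through_vertex:
  assumes "\<alpha> * t + \<beta> = 0" "b0 * t^2 + b1 * t + b2 = 0" "c0 * t^3 + c1 * t^2 + c2 * t + c3 = 0"
  shows "contains_line (cub \<alpha> \<beta> b0 b1 b2 c0 c1 c2 c3)"
proof -
  have \<beta>: "\<beta> = - (\<alpha> * t)" using assms(1) by (simp add: add_eq_0_iff)
  have b2: "b2 = - (b0 * t^2 + b1 * t)" using assms(2) by (metis add_eq_0_iff)
  have c3: "c3 = - (c0 * t^3 + c1 * t^2 + c2 * t)" using assms(3) by (metis add_eq_0_iff)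
  show ?thesis
  proof (rule contains_lineI)
    show "linear_form (\<lambda>x y z. x - t * y)" by (rule linear_formI[of _ 1 "- t" 0]) simp
    show "quadratic_form (\<lambda>x y z. c0 * x^2 + (c1 + t * c0) * x * y + (c2 + t * c1 + t^2 * c0) * y^2
         + b0 * x * z + (b1 + t * b0) * y * z + \<alpha> * z^2)" by (rule quadratic_formI) simp
  qed (simp add: cub_def \<beta> b2 c3 power2_eq_square power3_eq_cube algebra_simps)
qed

lemma prod_linear_dvd:
  fixes R :: "'a::idom poly"
  assumes "finite S" "\<And>s. s \<in> S \<Longrightarrow> poly R s = 0"
  shows "(\<Prod>s\<in>S. [:- s, 1:]) dvd R"
  using assms
proof (induction S)
  case empty
  show ?case by simp
next
  case (insert a S)
  then obtain T where T: "R = (\<Prod>s\<in>S. [:- s, 1:]) * T" by (auto elim: dvdE)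
  have "poly (\<Prod>s\<in>S. [:- s, 1:]) a \<noteq> 0" using insert.hyps by (auto simp: poly_prod)
  hence "poly T a = 0" using insert.prems[of a] by (simp add: T)
  then obtain T' where T': "T = [:- a, 1:] * T'" by (auto simp: poly_eq_0_iff_dvd elim: dvdE)
  hence "R = (\<Prod>s\<in>insert a S. [:- s, 1:]) * T'" unfolding prod.insert[OF insert.hyps] T T' by (simp only: mult_ac)
  thus ?case by (metis dvd_triv_left)
qed

text \<open>Coordinates are such that the eight points are \<open>(0, 0, 1)\<close> and \<open>(u i, 1, w i)\<close>.  In
  \<open>nonsingular\<close> the derivatives in the first and the third coordinate suffice, by Euler's relation.\<close>

locale normalised_points =
  fixes u w :: "nat \<Rightarrow> 'a::{field,finite}"
  assumes two: "(2::'a) \<noteq> 0" and three: "(3::'a) \<noteq> 0"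
    and u_inj: "inj_on u {..<7}"
    and no_line: "contains_line f \<Longrightarrow> f 0 0 1 = 0 \<Longrightarrow> (\<And>i. i < 7 \<Longrightarrow> f (u i) 1 (w i) = 0) \<Longrightarrow> f x y z = 0"
    and vertex_nonsingular: "(\<And>i. i < 7 \<Longrightarrow> cub 0 0 b0 b1 b2 c0 c1 c2 c3 (u i) 1 (w i) = 0)
       \<Longrightarrow> cub 0 0 b0 b1 b2 c0 c1 c2 c3 x y z = 0"
    and nonsingular: "(\<And>i. i < 7 \<Longrightarrow> cub \<alpha> \<beta> b0 b1 b2 c0 c1 c2 c3 (u i) 1 (w i) = 0) \<Longrightarrow> j < 7
       \<Longrightarrow> \<alpha> * (w j)^2 + (2 * b0 * u j + b1) * w j + (3 * c0 * (u j)^2 + 2 * c1 * u j + c2) = 0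
       \<Longrightarrow> 2 * (\<alpha> * u j + \<beta>) * w j + (b0 * (u j)^2 + b1 * u j + b2) = 0
       \<Longrightarrow> cub \<alpha> \<beta> b0 b1 b2 c0 c1 c2 c3 x y z = 0"
begin

text \<open>No nonzero cubic through the eight points is singular at \<open>(0, 0, 1)\<close>, so the seven values
  at the other points and the coefficients \<open>\<alpha>\<close>, \<open>\<beta>\<close> determine the nine coefficients.\<close>

lemma cub_interpolation:
  "\<exists>b0 b1 b2 c0 c1 c2 c3. \<forall>i<7. cub \<alpha> \<beta> b0 b1 b2 c0 c1 c2 c3 (u i) 1 (w i) = 0"
proof -
  define T where "T = (\<lambda>(\<alpha>, \<beta>, b0, b1, b2, c0, c1, c2, c3).
    let F = (\<lambda>i. cub \<alpha> \<beta> b0 b1 b2 c0 c1 c2 c3 (u i) 1 (w i)) in (\<alpha>, \<beta>, F 0, F 1, F 2, F 3, F 4, F 5, F 6))"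
  have less7: "i < 7 \<longleftrightarrow> i \<in> {0, 1, 2, 3, 4, 5, 6}" for i :: nat by auto
  have "inj T"
  proof (rule injI)
    fix v v' assume e: "T v = T v'"
    obtain \<alpha> \<beta> b0 b1 b2 c0 c1 c2 c3 where v: "v = (\<alpha>, \<beta>, b0, b1, b2, c0, c1, c2, c3)"
      by (metis surj_pair)
    obtain \<alpha>' \<beta>' d0 d1 d2 e0 e1 e2 e3 where v': "v' = (\<alpha>', \<beta>', d0, d1, d2, e0, e1, e2, e3)"
      by (metis surj_pair)
    have ab: "\<alpha>' = \<alpha>" "\<beta>' = \<beta>" using e by (auto simp: T_def v v' Let_def)
    have "cub \<alpha> \<beta> b0 b1 b2 c0 c1 c2 c3 (u i) 1 (w i) = cub \<alpha>' \<beta>' d0 d1 d2 e0 e1 e2 e3 (u i) 1 (w i)" if "i < 7" for i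
      using e that unfolding less7 T_def v v' Let_def by auto
    hence "cub 0 0 (b0 - d0) (b1 - d1) (b2 - d2) (c0 - e0) (c1 - e1) (c2 - e2) (c3 - e3) (u i) 1 (w i) = 0" if "i < 7" for i
      using cub_combination[of 1 \<alpha> "-1" \<alpha>' \<beta> \<beta>' b0 d0 b1 d1 b2 d2 c0 e0 c1 e1 c2 e2 c3 e3] that by (simp add: ab)
    from cub_eq_zero_coeffs[OF two vertex_nonsingular[OF this]]
    show "v = v'" by (simp add: v v' ab)
  qed
  \<comment> \<open>An injective self-map of the finite set of 9-tuples is surjective, so
    \<open>\<alpha>\<close>, \<open>\<beta>\<close> and seven zero values can be prescribed.\<close>
  hence "surj T" by (rule finite_UNIV_inj_surj[rotated]) simp
  then obtain v where e: "T v = (\<alpha>, \<beta>, 0, 0, 0, 0, 0, 0, 0)" by (metis surjD)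
  obtain \<alpha>' \<beta>' b0 b1 b2 c0 c1 c2 c3 where v: "v = (\<alpha>', \<beta>', b0, b1, b2, c0, c1, c2, c3)"
    by (metis surj_pair)
  have "\<forall>i<7. cub \<alpha> \<beta> b0 b1 b2 c0 c1 c2 c3 (u i) 1 (w i) = 0"
    using e unfolding less7 T_def v Let_def by auto
  thus ?thesis by blast
qed

end

text \<open>The generators have \<open>(\<alpha>, \<beta>) = (1, 0)\<close> and
  \<open>(0, 1)\<close>. Thus the combination with coefficients \<open>l\<close>, \<open>m\<close>
  has \<open>\<alpha> = l\<close>, \<open>\<beta> = m\<close> and is nonzero unless both are
  0.\<close>

locale pencil = normalised_points u w for u w :: "nat \<Rightarrow> 'a::{field,finite}" +
  fixes b0 b1 b2 c0 c1 c2 c3 d0 d1 d2 e0 e1 e2 e3 :: 'a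
  assumes vanish1: "i < 7 \<Longrightarrow> cub 1 0 b0 b1 b2 c0 c1 c2 c3 (u i) 1 (w i) = 0"
    and vanish2: "i < 7 \<Longrightarrow> cub 0 1 d0 d1 d2 e0 e1 e2 e3 (u i) 1 (w i) = 0"
begin

definition "f1 = cub 1 0 b0 b1 b2 c0 c1 c2 c3"
definition "f2 = cub 0 1 d0 d1 d2 e0 e1 e2 e3"

definition member :: "'a \<Rightarrow> 'a \<Rightarrow> 'a \<Rightarrow> 'a \<Rightarrow> 'a \<Rightarrow> 'a" where
  "member l m = cub l m (l * b0 + m * d0) (l * b1 + m * d1) (l * b2 + m * d2)
     (l * c0 + m * e0) (l * c1 + m * e1) (l * c2 + m * e2) (l * c3 + m * e3)"

lemma member_eq: "member l m x y z = l * f1 x y z + m * f2 x y z"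
  using cub_combination[of l 1 m 0 0 1] by (simp add: member_def f1_def f2_def)

lemma member_vanish: "i < 7 \<Longrightarrow> member l m (u i) 1 (w i) = 0"
  by (simp add: member_eq f1_def f2_def vanish1 vanish2)

lemma member_no_line:
  assumes "l \<noteq> 0 \<or> m \<noteq> 0"
  shows "\<not> contains_line (member l m)"
proof
  assume c: "contains_line (member l m)"
  obtain x y z where "member l m x y z \<noteq> 0" using cub_nonzero[OF two assms] unfolding member_def by blast
  moreover have "member l m 0 0 1 = 0" by (simp add: member_def cub_def)
  ultimately show False using no_line[OF c] member_vanish by blast
qed

text \<open>Along the line of slope \<open>x = u y\<close> through \<open>(0, 0, 1)\<close> the two cubics are quadratics
  \<open>u z\<^sup>2 + Q1 z + C1\<close> and \<open>z\<^sup>2 + Q2 z + C2\<close>; \<open>R\<close> is their resultant, of degree 8 in \<open>u\<close>.\<close>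

definition "Q1 = [:b2, b1, b0:]"
definition "C1 = [:c3, c2, c1, c0:]"
definition "Q2 = [:d2, d1, d0:]"
definition "C2 = [:e3, e2, e1, e0:]"
text \<open>Elimination of \<open>z^2\<close>: on the line of slope \<open>u\<close>,
  \<open>u f2 - f1\<close> is \<open>A z + B\<close>.\<close>

definition "A = [:0, 1:] * Q2 - Q1"
definition "B = [:0, 1:] * C2 - C1"
definition "R = B^2 - A * (Q1 * C2 - Q2 * C1)"

lemma f1_affine: "f1 t 1 z = t * z^2 + poly Q1 t * z + poly C1 t"
  by (simp add: f1_def cub_def Q1_def C1_def power2_eq_square power3_eq_cube algebra_simps)

lemma f2_affine: "f2 t 1 z = z^2 + poly Q2 t * z + poly C2 t"
  by (simp add: f2_def cub_def Q2_def C2_def power2_eq_square power3_eq_cube algebra_simps)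

lemma poly_A: "poly A t = t * poly Q2 t - poly Q1 t" and poly_B: "poly B t = t * poly C2 t - poly C1 t"
  by (simp_all add: A_def B_def)

text \<open>Together with \<open>R2\<close>: inserting \<open>z = - B / A\<close> into the two
  quadratics and clearing denominators by \<open>A^2\<close> gives \<open>u R\<close> and
  \<open>R\<close>.\<close>

lemma R1: "[:0, 1:] * R = [:0, 1:] * B^2 - A * B * Q1 + A^2 * C1"
  unfolding R_def A_def B_def by (simp only: power2_eq_square ring_distribs mult_ac) (simp add: algebra_simps)

lemma R2: "R = B^2 - A * B * Q2 + A^2 * C2"
  unfolding R_def A_def B_def by (simp only: power2_eq_square ring_distribs mult_ac) (simp add: algebra_simps)

text \<open>If \<open>A\<close> vanishes at a root of \<open>R\<close>, so does \<open>B\<close>;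
  then \<open>f1 - t f2\<close> vanishes on the whole line \<open>x = t y\<close>, and a member of
  the pencil contains a line.\<close>

lemma A_nonzero:
  assumes "poly R t = 0"
  shows "poly A t \<noteq> 0"
proof
  assume A: "poly A t = 0"
  hence B: "poly B t = 0" using assms by (simp add: R_def)
  have "contains_line (member 1 (- t))" unfolding member_def
  proof (rule cub_contains_line_through_vertex[of _ t])
    show "1 * t + - t = 0" by simp
    have "- poly A t = (1 * b0 + - t * d0) * t^2 + (1 * b1 + - t * d1) * t + (1 * b2 + - t * d2)"
      by (simp add: poly_A Q1_def Q2_def power2_eq_square algebra_simps)
    thus "(1 * b0 + - t * d0) * t^2 + (1 * b1 + - t * d1) * t + (1 * b2 + - t * d2) = 0" using A by simp
    have "- poly B t = (1 * c0 + - t * e0) * t^3 + (1 * c1 + - t * e1) * t^2 + (1 * c2 + - t * e2) * t + (1 * c3 + - t * e3)"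
      by (simp add: poly_B C1_def C2_def power2_eq_square power3_eq_cube algebra_simps)
    thus "(1 * c0 + - t * e0) * t^3 + (1 * c1 + - t * e1) * t^2 + (1 * c2 + - t * e2) * t + (1 * c3 + - t * e3) = 0"
      using B by simp
  qed
  moreover have "\<not> contains_line (member 1 (- t))" by (rule member_no_line) simp
  ultimately show False by simp
qed

lemma common_zero_root:
  assumes "f1 t 1 z = 0" "f2 t 1 z = 0"
  shows "poly B t = - poly A t * z" "poly R t = 0"
proof -
  have "poly A t * z + poly B t = t * f2 t 1 z - f1 t 1 z"
    by (simp add: f1_affine f2_affine poly_A poly_B algebra_simps)
  hence "poly A t * z + poly B t = 0" using assms by simp
  thus B: "poly B t = - poly A t * z" by (simp add: eq_neg_iff_add_eq_0 add.commute)
  have "poly R t = poly A t ^ 2 * f2 t 1 z"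
    unfolding R2 by (simp add: B f2_affine power2_eq_square algebra_simps)
  thus "poly R t = 0" using assms by simp
qed

lemma root_common_zero:
  assumes "poly R t = 0"
  defines "z \<equiv> - poly B t / poly A t"
  shows "f1 t 1 z = 0" "f2 t 1 z = 0"
proof -
  have A: "poly A t \<noteq> 0" using A_nonzero assms(1) by simp
  have B: "poly B t = - poly A t * z" using A by (simp add: z_def)
  have "poly A t ^ 2 * f1 t 1 z = poly ([:0, 1:] * B^2 - A * B * Q1 + A^2 * C1) t"
    by (simp add: B f1_affine power2_eq_square algebra_simps)
  also have "\<dots> = 0" unfolding R1[symmetric] using assms(1) by simp
  finally show "f1 t 1 z = 0" using A by simp
  have "poly A t ^ 2 * f2 t 1 z = poly (B^2 - A * B * Q2 + A^2 * C2) t"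
    by (simp add: B f2_affine power2_eq_square algebra_simps)
  also have "\<dots> = 0" unfolding R2[symmetric] using assms(1) by simp
  finally show "f2 t 1 z = 0" using A by simp
qed

lemma root_u: "i < 7 \<Longrightarrow> poly R (u i) = 0"
  using common_zero_root(2)[of "u i" "w i"] vanish1 vanish2 by (simp add: f1_def f2_def)

text \<open>At a double root the branch \<open>z = - B / A\<close> is tangent to both cubics, so that some member of
  the pencil is singular there.\<close>

lemma root_u_simple:
  assumes j: "j < 7"
  shows "poly (pderiv R) (u j) \<noteq> 0"
proof
  assume R': "poly (pderiv R) (u j) = 0"
  let ?t = "u j" and ?z = "w j"
  have z1: "f1 ?t 1 ?z = 0" and z2: "f2 ?t 1 ?z = 0" using vanish1 vanish2 j by (auto simp: f1_def f2_def)
  define a where "a = poly A ?t"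
  define a' where "a' = poly (pderiv A) ?t"
  define b' where "b' = poly (pderiv B) ?t"
  define q1 where "q1 = poly Q1 ?t"
  define q1' where "q1' = poly (pderiv Q1) ?t"
  define q2 where "q2 = poly Q2 ?t"
  define q2' where "q2' = poly (pderiv Q2) ?t"
  define k1' where "k1' = poly (pderiv C1) ?t"
  define k2' where "k2' = poly (pderiv C2) ?t"
  have a: "a \<noteq> 0" using A_nonzero root_u[OF j] by (simp add: a_def)
  have B: "poly B ?t = - a * ?z" using common_zero_root(1)[OF z1 z2] by (simp add: a_def)
  have C1: "poly C1 ?t = - (?t * ?z^2 + q1 * ?z)"
  proof -
    have "poly C1 ?t = f1 ?t 1 ?z - (?t * ?z^2 + q1 * ?z)" by (simp add: f1_affine q1_def)
    thus ?thesis by (simp add: z1)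
  qed
  have C2: "poly C2 ?t = - (?z^2 + q2 * ?z)"
  proof -
    have "poly C2 ?t = f2 ?t 1 ?z - (?z^2 + q2 * ?z)" by (simp add: f2_affine q2_def)
    thus ?thesis by (simp add: z2)
  qed
  \<comment> \<open>The slope of the branch \<open>z = - B / A\<close> at this point is
    \<open>- (b' + a' z) / a\<close>. Differentiating \<open>R1\<close> and \<open>R2\<close> thus
    says that the derivatives of \<open>f1\<close> and \<open>f2\<close> along the branch
    vanish.\<close>
  have "0 = poly (pderiv ([:0, 1:] * R)) ?t"
    using R' root_u[OF j] by (simp add: pderiv_mult pderiv_pCons)
  also have "\<dots> = a * (a * (?z^2 + q1' * ?z + k1') - (b' + a' * ?z) * (2 * ?t * ?z + q1))"
    unfolding R1 power2_eq_square[of A] power2_eq_square[of B] pderiv_add pderiv_diff pderiv_mult pderiv_pCons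
    by (simp add: B C1 a_def[symmetric] a'_def[symmetric] b'_def[symmetric] q1_def[symmetric]
        q1'_def[symmetric] k1'_def[symmetric] power2_eq_square algebra_simps)
  finally have 1: "a * (?z^2 + q1' * ?z + k1') = (b' + a' * ?z) * (2 * ?t * ?z + q1)" using a by simp
  have "0 = poly (pderiv R) ?t" using R' by simp
  also have "\<dots> = a * (a * (q2' * ?z + k2') - (b' + a' * ?z) * (2 * ?z + q2))"
    unfolding R2 power2_eq_square[of A] power2_eq_square[of B] pderiv_add pderiv_diff pderiv_mult
    by (simp add: B C2 a_def[symmetric] a'_def[symmetric] b'_def[symmetric] q2_def[symmetric]
        q2'_def[symmetric] k2'_def[symmetric] power2_eq_square algebra_simps)
  finally have 2: "a * (q2' * ?z + k2') = (b' + a' * ?z) * (2 * ?z + q2)" using a by simp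
  \<comment> \<open>The member is chosen so that its derivative in \<open>z\<close> vanishes;
    tangency to the branch then forces its derivative in \<open>x\<close> to vanish as well.\<close>
  obtain l m where lm: "l \<noteq> 0 \<or> m \<noteq> 0" and 0: "l * (2 * ?t * ?z + q1) + m * (2 * ?z + q2) = 0"
  proof -
    have "\<exists>l m. (l \<noteq> 0 \<or> m \<noteq> 0) \<and> l * s + m * r = 0" for s r :: 'a
    proof (cases "s = 0")
      case True
      then show ?thesis by (intro exI[of _ 1] exI[of _ 0]) simp
    next
      case False
      then show ?thesis by (intro exI[of _ r] exI[of _ "- s"]) simp
    qed
    thus ?thesis using that by blast
  qed
  have "a * (l * (?z^2 + q1' * ?z + k1') + m * (q2' * ?z + k2'))
      = l * (a * (?z^2 + q1' * ?z + k1')) + m * (a * (q2' * ?z + k2'))" by (simp add: algebra_simps)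
  also have "\<dots> = (b' + a' * ?z) * (l * (2 * ?t * ?z + q1) + m * (2 * ?z + q2))"
    unfolding 1 2 by (simp add: algebra_simps)
  finally have 3: "l * (?z^2 + q1' * ?z + k1') + m * (q2' * ?z + k2') = 0" using a 0 by simp
  obtain x y z where "member l m x y z \<noteq> 0" using cub_nonzero[OF two lm] unfolding member_def by blast
  moreover have "member l m x y z = 0" unfolding member_def
  proof (rule nonsingular[OF _ j])
    have "l * ?z^2 + (2 * (l * b0 + m * d0) * ?t + (l * b1 + m * d1)) * ?z
       + (3 * (l * c0 + m * e0) * ?t^2 + 2 * (l * c1 + m * e1) * ?t + (l * c2 + m * e2))
       = l * (?z^2 + q1' * ?z + k1') + m * (q2' * ?z + k2')"
      by (simp add: q1'_def q2'_def k1'_def k2'_def Q1_def Q2_def C1_def C2_def pderiv_pCons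
          power2_eq_square algebra_simps)
    thus "l * ?z^2 + (2 * (l * b0 + m * d0) * ?t + (l * b1 + m * d1)) * ?z
       + (3 * (l * c0 + m * e0) * ?t^2 + 2 * (l * c1 + m * e1) * ?t + (l * c2 + m * e2)) = 0"
      using 3 by simp
    have "2 * (l * ?t + m) * ?z + ((l * b0 + m * d0) * ?t^2 + (l * b1 + m * d1) * ?t + (l * b2 + m * d2))
       = l * (2 * ?t * ?z + q1) + m * (2 * ?z + q2)"
      by (simp add: q1_def q2_def Q1_def Q2_def power2_eq_square algebra_simps)
    thus "2 * (l * ?t + m) * ?z + ((l * b0 + m * d0) * ?t^2 + (l * b1 + m * d1) * ?t + (l * b2 + m * d2)) = 0"
      using 0 by simp
  qed (use member_vanish in \<open>simp add: member_def\<close>)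
  ultimately show False by simp
qed

text \<open>This coefficient is the resultant of \<open>z^2 + b0 z + c0\<close> and
  \<open>d0 z + e0\<close>, the restrictions of the generators to the line \<open>y = 0\<close>. Its
  vanishing is a root of \<open>R\<close> at infinity.\<close>

lemma coeff_R_8: "coeff R 8 = e0^2 - d0 * (b0 * e0 - d0 * c0)" and degree_R: "degree R \<le> 8"
proof -
  have R: "R = [:0, 1:] * R + (R - [:0, 1:] * R)" by simp
  show "coeff R 8 = e0^2 - d0 * (b0 * e0 - d0 * c0)"
    by (simp add: R_def A_def B_def Q1_def Q2_def C1_def C2_def power2_eq_square numeral_eq_Suc algebra_simps)
  show "degree R \<le> 8"
    by (rule degree_le) (auto simp: R_def A_def B_def Q1_def Q2_def C1_def C2_def power2_eq_square
      coeff_pCons coeff_eq_0 split: nat.splits)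
qed

text \<open>If \<open>R\<close> has degree less than 8, the ninth point lies on
  \<open>y = 0\<close>. Otherwise \<open>R\<close> is the product of the seven known linear factors
  and one more, whose root is new because the known roots are simple.\<close>

lemma ninth_point:
  "\<exists>x y z. f1 x y z = 0 \<and> f2 x y z = 0 \<and> (x = 1 \<and> y = 0 \<or> y = 1 \<and> x \<notin> u ` {..<7})"
proof (cases "coeff R 8 = 0")
  case True
  have f: "f1 1 0 z = z^2 + b0 * z + c0" "f2 1 0 z = d0 * z + e0" for z
    by (simp_all add: f1_def f2_def cub_def)
  have R8: "e0^2 - d0 * (b0 * e0 - d0 * c0) = 0" using True coeff_R_8 by simp
  \<comment> \<open>Otherwise \<open>e0 = 0\<close> too, and \<open>f2\<close> contains the line
    \<open>y = 0\<close>.\<close>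
  have d0: "d0 \<noteq> 0"
  proof
    assume d0: "d0 = 0"
    hence e0: "e0 = 0" using R8 by simp
    have "contains_line (member 0 1)" unfolding member_def using cub_contains_line_at_infinity
      by (simp add: d0 e0)
    thus False using member_no_line[of 0 1] by simp
  qed
  define z where "z = - e0 / d0"
  have e0: "e0 = - d0 * z" using d0 by (simp add: z_def)
  have "d0^2 * f1 1 0 z = e0^2 - d0 * (b0 * e0 - d0 * c0)"
    unfolding f e0 by (simp add: power2_eq_square algebra_simps)
  hence "f1 1 0 z = 0" using R8 d0 by simp
  moreover have "f2 1 0 z = 0" unfolding f using e0 by simp
  ultimately show ?thesis by blast
next
  case False
  define W where "W = (\<Prod>s\<in>u ` {..<7}. [:- s, 1:])"
  have card: "card (u ` {..<7}) = 7" using u_inj by (simp add: card_image)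
  have degW: "degree W = 7" unfolding W_def by (subst degree_prod_sum_eq) (auto simp: card)
  have "W dvd R" unfolding W_def by (rule prod_linear_dvd) (auto simp: root_u)
  then obtain L where L: "R = W * L" by (rule dvdE)
  have degR: "degree R = 8" using degree_R False le_degree le_antisym by blast
  have R0: "R \<noteq> 0" using False by auto
  hence "W \<noteq> 0" "L \<noteq> 0" using L by auto
  hence "degree L = 1" using degR degW by (simp add: L degree_mult_eq)
  then obtain p q where pq: "L = [:p, q:]" "q \<noteq> 0" by (metis degree1_coeffs degree_pCons_eq_if one_neq_zero)
  define t where "t = - p / q"
  have Lt: "poly L t = 0" using pq by (simp add: t_def)
  have "t \<notin> u ` {..<7}"
  proof
    assume t: "t \<in> u ` {..<7}"
    hence "poly W t = 0" unfolding W_def by (auto simp: poly_prod)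
    hence "poly (pderiv R) t = 0" using Lt by (simp add: L pderiv_mult)
    with t root_u_simple show False by auto
  qed
  moreover have "poly R t = 0" using Lt by (simp add: L)
  ultimately show ?thesis using root_common_zero by blast
qed

section \<open>Double counting of members and vectors\<close>

definition "base = {(x, y, z). f1 x y z = 0 \<and> f2 x y z = 0}"

lemma card_base: "1 + 9 * (CARD('a) - 1) \<le> card base"
proof -
  obtain x9 y9 z9 where f9: "f1 x9 y9 z9 = 0" "f2 x9 y9 z9 = 0"
    and n9: "x9 = 1 \<and> y9 = 0 \<or> y9 = 1 \<and> x9 \<notin> u ` {..<7}" using ninth_point by blast
  define P where "P = {(0, 0, 1), (x9, y9, z9)} \<union> (\<lambda>i. (u i, 1, w i)) ` {..<7}"
  define h where "h = (\<lambda>(k, x, y, z). (k * x, k * y, k * z :: 'a))"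
  \<comment> \<open>The nine representatives are normalised, so multiples of different ones are
    different; with the zero vector this gives \<open>1 + 9 (q - 1)\<close> vectors.\<close>
  have norm: "y = 1 \<or> y = 0 \<and> x = 1 \<or> (x, y, z) = (0, 0, 1)" if "(x, y, z) \<in> P" for x y z
    using that n9 by (auto simp: P_def)
  have f0: "f1 0 0 1 = 0" "f2 0 0 1 = 0" by (simp_all add: f1_def f2_def cub_def)
  have fP: "f1 x y z = 0" "f2 x y z = 0" if "(x, y, z) \<in> P" for x y z
    using that f9 f0 vanish1 vanish2 by (auto simp: P_def f1_def f2_def)
  have hom: "f1 (k * x) (k * y) (k * z) = k^3 * f1 x y z" "f2 (k * x) (k * y) (k * z) = k^3 * f2 x y z" for k x y z
    by (simp_all add: f1_def f2_def cub_homogeneous)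
  have cP: "card P = 9"
  proof -
    have "card ((\<lambda>i. (u i, 1::'a, w i)) ` {..<7}) = 7"
      using u_inj by (subst card_image) (auto simp: inj_on_def)
    moreover have "(x9, y9, z9) \<notin> (\<lambda>i. (u i, 1, w i)) ` {..<7}" using n9 by auto
    moreover have "(0, 0, 1) \<notin> insert (x9, y9, z9) ((\<lambda>i. (u i, 1, w i)) ` {..<7})" using n9 by auto
    ultimately show ?thesis by (simp add: P_def)
  qed
  have "inj_on h ((UNIV - {0}) \<times> P)"
  proof (rule inj_onI)
    fix v v' assume "v \<in> (UNIV - {0}) \<times> P" "v' \<in> (UNIV - {0}) \<times> P" and e: "h v = h v'"
    then obtain k x y z k' x' y' z' where v: "v = (k, x, y, z)" "v' = (k', x', y', z')"
      and k: "k \<noteq> 0" "k' \<noteq> 0" and n: "(x, y, z) \<in> P" "(x', y', z') \<in> P"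
      by (metis Diff_iff UNIV_I insertI1 mem_Times_iff prod.collapse)
    from e have "k * x = k' * x'" "k * y = k' * y'" "k * z = k' * z'" by (auto simp: h_def v)
    with norm[OF n(1)] norm[OF n(2)] k show "v = v'" by (auto simp: v)
  qed
  hence "card (h ` ((UNIV - {0}) \<times> P)) = (CARD('a) - 1) * 9"
    by (simp add: card_image card_cartesian_product card_Diff_singleton cP)
  moreover have "(0, 0, 0) \<notin> h ` ((UNIV - {0}) \<times> P)"
  proof
    assume "(0, 0, 0) \<in> h ` ((UNIV - {0}) \<times> P)"
    then obtain v where v: "v \<in> (UNIV - {0}) \<times> P" "(0, 0, 0) = h v" by (rule imageE)
    obtain k x y z where "v = (k, x, y, z)" by (metis surj_pair)
    with v norm[of x y z] show False by (auto simp: h_def)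
  qed
  ultimately have "card (insert (0, 0, 0) (h ` ((UNIV - {0}) \<times> P))) = 1 + 9 * (CARD('a) - 1)"
    by simp
  moreover have "insert (0, 0, 0) (h ` ((UNIV - {0}) \<times> P)) \<subseteq> base"
    using fP by (auto simp: base_def h_def hom) (simp_all add: f1_def f2_def cub_def)
  hence "card (insert (0, 0, 0) (h ` ((UNIV - {0}) \<times> P))) \<le> card base" by (intro card_mono) auto
  ultimately show ?thesis by simp
qed

text \<open>Count the pairs of a member of the pencil and a vector on which it vanishes.\<close>

lemma pencil_count:
  assumes bound: "\<And>a b::'a. card {(u, w). w^2 = u^3 + a * u + b} \<le> Bd"
  shows "CARD('a) * CARD('a)^3 + (CARD('a)^2 - CARD('a)) * (1 + 9 * (CARD('a) - 1))
    \<le> CARD('a)^3 + (CARD('a)^2 - 1) * (CARD('a) + (CARD('a) - 1) * Bd)"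
proof -
  let ?q = "CARD('a)"
  define I where "I = (SIGMA lm:(UNIV :: ('a \<times> 'a) set). zeros (member (fst lm) (snd lm)))"
  define J where "J = (SIGMA v:(UNIV :: ('a \<times> 'a \<times> 'a) set).
    {(l, m). l * f1 (fst v) (fst (snd v)) (snd (snd v)) + m * f2 (fst v) (fst (snd v)) (snd (snd v)) = 0})"
  have "card I = card J"
    by (rule card_eq_by_bij[where f = "\<lambda>(a, b). (b, a)" and g = "\<lambda>(a, b). (b, a)"])
      (auto simp: I_def J_def zeros_def member_eq)
  have CV: "card (UNIV :: ('a \<times> 'a \<times> 'a) set) = ?q^3" by (simp add: power3_eq_cube)
  have CL: "card (UNIV :: ('a \<times> 'a) set) = ?q^2" by (simp add: power2_eq_square)
  have "card I = (\<Sum>lm\<in>UNIV. card (zeros (member (fst lm) (snd lm))))"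
    unfolding I_def by (rule card_SigmaI) auto
  \<comment> \<open>The pair \<open>(0, 0)\<close> gives the zero form, which vanishes on all
    \<open>q^3\<close> vectors, and is split off.\<close>
  also have "\<dots> = card (zeros (member 0 0)) + (\<Sum>lm\<in>UNIV - {(0, 0)}. card (zeros (member (fst lm) (snd lm))))"
    by (subst sum.remove[of _ "(0, 0)"]) auto
  also have "\<dots> \<le> ?q^3 + (\<Sum>lm\<in>(UNIV - {(0, 0)} :: ('a \<times> 'a) set). ?q + (?q - 1) * Bd)"
  proof (intro add_mono sum_mono)
    show "card (zeros (member 0 0)) \<le> ?q^3" unfolding CV[symmetric] by (rule card_mono) auto
    fix lm :: "'a \<times> 'a" assume "lm \<in> UNIV - {(0, 0)}"
    hence lm: "fst lm \<noteq> 0 \<or> snd lm \<noteq> 0" by (auto simp: prod_eq_iff)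
    show "card (zeros (member (fst lm) (snd lm))) \<le> ?q + (?q - 1) * Bd"
      using member_no_line[OF lm] unfolding member_def by (intro card_zeros_cub[OF two three bound lm])
  qed
  also have "\<dots> = ?q^3 + (?q^2 - 1) * (?q + (?q - 1) * Bd)"
    unfolding sum_constant card_Diff_singleton[OF UNIV_I] CL by simp
  finally have up: "card I \<le> ?q^3 + (?q^2 - 1) * (?q + (?q - 1) * Bd)" .
  \<comment> \<open>For a fixed vector the condition on \<open>(l, m)\<close> is one linear
    equation: it is trivial on the base locus and otherwise has the multiples of
    \<open>(f2, - f1)\<close> as solutions.\<close>
  have fib: "?q + (if v \<in> base then ?q^2 - ?q else 0)
     \<le> card {(l, m). l * f1 (fst v) (fst (snd v)) (snd (snd v)) + m * f2 (fst v) (fst (snd v)) (snd (snd v)) = 0}" for v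
  proof -
    obtain x y z where v: "v = (x, y, z)" by (metis surj_pair)
    show ?thesis
    proof (cases "v \<in> base")
      case True
      then have "{(l, m). l * f1 x y z + m * f2 x y z = 0} = UNIV" by (auto simp: base_def v)
      moreover have "?q \<le> ?q^2" by (simp add: power2_eq_square)
      ultimately show ?thesis using True CL by (simp add: v)
    next
      case False
      have "inj (\<lambda>k. (k * f2 x y z, - k * f1 x y z))"
        using False by (auto simp: inj_def base_def v)
      hence "?q = card (range (\<lambda>k. (k * f2 x y z, - k * f1 x y z)))" by (simp add: card_image)
      also have "\<dots> \<le> card {(l, m). l * f1 x y z + m * f2 x y z = 0}" by (rule card_mono) auto
      finally show ?thesis using False by (simp add: v)
    qed
  qed
  have "?q * ?q^3 + (?q^2 - ?q) * (1 + 9 * (?q - 1)) \<le> ?q * ?q^3 + (?q^2 - ?q) * card base"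
    by (intro add_mono mult_le_mono le_refl card_base)
  also have "\<dots> = (\<Sum>v\<in>UNIV. ?q + (if v \<in> base then ?q^2 - ?q else 0))"
    unfolding sum.distrib sum.If_cases[OF finite] by (simp add: power3_eq_cube)
  also have "\<dots> \<le> (\<Sum>v\<in>UNIV. card {(l, m). l * f1 (fst v) (fst (snd v)) (snd (snd v)) + m * f2 (fst v) (fst (snd v)) (snd (snd v)) = 0})"
    by (rule sum_mono) (rule fib)
  also have "\<dots> = card J" unfolding J_def by (rule card_SigmaI[symmetric]) auto
  finally show ?thesis using up \<open>card I = card J\<close> by simp
qed

end

lemma (in normalised_points) points_count:
  assumes "\<And>a b::'a. card {(u, w). w^2 = u^3 + a * u + b} \<le> Bd"
  shows "CARD('a) * CARD('a)^3 + (CARD('a)^2 - CARD('a)) * (1 + 9 * (CARD('a) - 1))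
    \<le> CARD('a)^3 + (CARD('a)^2 - 1) * (CARD('a) + (CARD('a) - 1) * Bd)"
proof -
  obtain b0 b1 b2 c0 c1 c2 c3 where 1: "\<forall>i<7. cub 1 0 b0 b1 b2 c0 c1 c2 c3 (u i) 1 (w i) = 0"
    using cub_interpolation by blast
  obtain d0 d1 d2 e0 e1 e2 e3 where 2: "\<forall>i<7. cub 0 1 d0 d1 d2 e0 e1 e2 e3 (u i) 1 (w i) = 0"
    using cub_interpolation by blast
  interpret pencil u w b0 b1 b2 c0 c1 c2 c3 d0 d1 d2 e0 e1 e2 e3
    by unfold_locales (use 1 2 in auto)
  show ?thesis by (rule pencil_count[OF assms])
qed

section \<open>Coordinates\<close>

lemma ex_subset_card_image:
  assumes "finite A" "inj_on P A" "k \<le> card A"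
  shows "\<exists>T\<subseteq>P ` A. card T = k"
  using assms by (metis card_image finite_imageI obtain_subset_with_card_n)

text \<open>Curves enter through a form with a nonzero value at some \<open>x\<close>. A nonzero
  value forces a nonzero polynomial, so the conditions follow from those on curves even over a
  finite field.\<close>

locale general_position =
  fixes v :: "nat \<Rightarrow> 'a::field ^ 3"
  assumes nonzero: "i < 8 \<Longrightarrow> v i \<noteq> 0"
    and distinct: "i < 8 \<Longrightarrow> j < 8 \<Longrightarrow> i \<noteq> j \<Longrightarrow> v i \<noteq> c *s v j"
    and on_line: "lin a x \<noteq> 0 \<Longrightarrow> card {i\<in>{..<8}. lin a (v i) = 0} \<le> 2"
    and on_conic: "form 2 g E \<Longrightarrow> g x \<noteq> 0 \<Longrightarrow> card {i\<in>{..<8}. g (v i) = 0} \<le> 5"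
    and cubic_nonsingular: "form 3 f D \<Longrightarrow> f x \<noteq> 0 \<Longrightarrow> (\<And>i. i < 8 \<Longrightarrow> f (v i) = 0) \<Longrightarrow> j < 8
       \<Longrightarrow> \<exists>k. D k (v j) \<noteq> 0"

lemma general_position_of_eight_points:
  fixes S :: "('a::field ^ 3) set set"
  assumes S: "eight_points_in_general_position S"
  shows "\<exists>v :: nat \<Rightarrow> 'a ^ 3. general_position v"
proof -
  have sub: "S \<subseteq> proj_plane" and c8: "card S = 8"
    and noL: "\<not> (\<exists>L. plane_curve 1 L \<and> (\<exists>T\<subseteq>S. card T = 3 \<and> (\<forall>P\<in>T. vanishes_at L P)))"
    and noQ: "\<not> (\<exists>L. plane_curve 2 L \<and> (\<exists>T\<subseteq>S. card T = 6 \<and> (\<forall>P\<in>T. vanishes_at L P)))"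
    and noC: "\<not> (\<exists>C. plane_curve 3 C \<and> (\<forall>P\<in>S. vanishes_at C P) \<and> (\<exists>P\<in>S. singular_at C P))"
    using S[unfolded eight_points_in_general_position_def] by blast+
  have "finite S" using c8 by (intro card_ge_0_finite) simp
  then obtain P where P: "bij_betw P {..<8::nat} S"
    using ex_bij_betw_nat_finite[of S] unfolding c8 lessThan_atLeast0 by blast
  have "\<exists>w. w \<noteq> 0 \<and> P i = vec.span {w}" if "i < 8" for i
    using that P sub unfolding bij_betw_def proj_plane_def by blast
  then obtain v where v0: "\<And>i. i < 8 \<Longrightarrow> v i \<noteq> 0" and v: "\<And>i. i < 8 \<Longrightarrow> P i = vec.span {v i}" by metis
  have inP: "x \<in> P i \<longleftrightarrow> (\<exists>c. x = c *s v i)" if "i < 8" for x i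
    using v[OF that] by (auto simp: vec.span_singleton)
  \<comment> \<open>By homogeneity, vanishing at a point can be tested on one spanning
    vector.\<close>
  have vanish: "vanishes_at F (P i) \<longleftrightarrow> poly_eval F (v i) = 0" if "homogeneous d F" "i < 8" for F d i
  proof
    assume "vanishes_at F (P i)"
    moreover have "v i \<in> P i" using inP[OF that(2)] by (metis vec.scale_one)
    ultimately show "poly_eval F (v i) = 0" using v0[OF that(2)] by (simp add: vanishes_at_def)
  next
    assume "poly_eval F (v i) = 0"
    thus "vanishes_at F (P i)" unfolding vanishes_at_def
      using inP[OF that(2)] poly_eval_scale[OF that(1)] by auto
  qed
  have inj: "inj_on P {..<8}" and im: "P ` {..<8} = S" using P by (auto simp: bij_betw_def)
  have curve: "card {i\<in>{..<8}. f (v i) = 0} < k"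
    if f: "form d f D" "f x \<noteq> 0" and no: "\<not> (\<exists>L. plane_curve d L \<and> (\<exists>T\<subseteq>S. card T = k \<and> (\<forall>P\<in>T. vanishes_at L P)))"
    for d f D x k
  proof (rule ccontr)
    let ?A = "{i\<in>{..<8}. f (v i) = 0}"
    assume "\<not> card ?A < k"
    moreover have "inj_on P ?A" using inj by (rule inj_on_subset) auto
    ultimately obtain T where T: "T \<subseteq> P ` ?A" "card T = k"
      using ex_subset_card_image[of ?A P k] by auto
    obtain F where F: "homogeneous d F" "\<And>x. poly_eval F x = f x" using f(1) unfolding form_def by blast
    have "F \<noteq> 0" using f(2) F(2)[of x] by (auto simp: poly_eval_def)
    moreover have "\<forall>Q\<in>T. vanishes_at F Q"
    proof
      fix Q assume "Q \<in> T"
      with T obtain i where i: "Q = P i" "i < 8" "f (v i) = 0" by auto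
      thus "vanishes_at F Q" using vanish[OF F(1) i(2)] F(2) by simp
    qed
    moreover have "T \<subseteq> S" using T im by auto
    ultimately show False using no F(1) T(2) unfolding plane_curve_def by blast
  qed
  have "general_position v"
  proof
    show "v i \<noteq> 0" if "i < 8" for i using v0 that .
    show "v i \<noteq> c *s v j" if "i < 8" "j < 8" "i \<noteq> j" for i j c
    proof
      assume e: "v i = c *s v j"
      hence "c \<noteq> 0" using v0[OF that(1)] by auto
      have "P i = P j"
      proof (rule Set.set_eqI)
        fix x
        have "(\<exists>k. x = k *s v i) \<longleftrightarrow> (\<exists>k. x = k *s v j)"
        proof
          assume "\<exists>k. x = k *s v i"
          thus "\<exists>k. x = k *s v j" unfolding e by (auto simp: vec.scale_scale)
        next
          assume "\<exists>k. x = k *s v j"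
          then obtain k where "x = k *s v j" by blast
          hence "x = (k / c) *s v i" unfolding e using \<open>c \<noteq> 0\<close> by (simp add: vec.scale_scale)
          thus "\<exists>k. x = k *s v i" by blast
        qed
        thus "x \<in> P i \<longleftrightarrow> x \<in> P j" using inP that by simp
      qed
      with inj that show False by (auto simp: inj_on_def)
    qed
    show "card {i\<in>{..<8}. lin a (v i) = 0} \<le> 2" if "lin a x \<noteq> 0" for a x
      using curve[OF form_lin that, of 3] noL by simp
    show "card {i\<in>{..<8}. g (v i) = 0} \<le> 5" if "form 2 g E" "g x \<noteq> 0" for g E x
      using curve[OF that, of 6] noQ by simp
    show "\<exists>k. D k (v j) \<noteq> 0" if f: "form 3 f D" "f x \<noteq> 0" and z: "\<And>i. i < 8 \<Longrightarrow> f (v i) = 0" and j: "j < 8" for f D x j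
    proof (rule ccontr)
      assume "\<not> ?thesis"
      hence D: "\<And>k. D k (v j) = 0" by blast
      obtain F where F: "homogeneous 3 F" "\<And>x. poly_eval F x = f x" "\<And>i x. poly_eval (partial_deriv i F) x = D i x"
        using f(1) unfolding form_def by blast
      have "F \<noteq> 0" using f(2) F(2)[of x] by (auto simp: poly_eval_def)
      moreover have all: "vanishes_at F Q" if "Q \<in> S" for Q
        using that vanish[OF F(1)] z F(2) unfolding im[symmetric] by auto
      moreover have "vanishes_at (partial_deriv k F) (P j)" for k
        unfolding vanishes_at_def
        using inP[OF j] poly_eval_partial_scale[OF F(1)] F(3) D by auto
      moreover have "P j \<in> S" using im j by auto
      ultimately have "plane_curve 3 F \<and> (\<forall>P\<in>S. vanishes_at F P) \<and> (\<exists>P\<in>S. singular_at F P)"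
        using F(1) unfolding plane_curve_def singular_at_def by blast
      thus False using noC by blast
    qed
  qed
  thus ?thesis by (rule exI[of general_position v])
qed

section \<open>Linear coordinates centred at one of the points\<close>

lemma lin3: "lin a x = a $ 1 * x $ 1 + a $ 2 * x $ 2 + a $ 3 * x $ 3"
  by (simp add: lin_def sum_3)

text \<open>A coordinate system in which \<open>p\<close> becomes \<open>(0, 0, 1)\<close>, written
  down according to which entry of \<open>p\<close> is nonzero.\<close>

lemma coordinates_at:
  fixes p :: "'a::field ^ 3"
  assumes "p \<noteq> 0"
  shows "\<exists>a b c. lin a p = 0 \<and> lin b p = 0 \<and> lin c p = 1
    \<and> (\<forall>x. lin a x = 0 \<longrightarrow> lin b x = 0 \<longrightarrow> lin c x = 0 \<longrightarrow> x = 0)"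
proof -
  consider "p $ 3 \<noteq> 0" | "p $ 3 = 0" "p $ 2 \<noteq> 0" | "p $ 3 = 0" "p $ 2 = 0" "p $ 1 \<noteq> 0"
    using assms by (auto simp: vec_eq_iff forall_3)
  then show ?thesis
  proof cases
    case 1
    then show ?thesis
      by (intro exI[of _ "vector [p $ 3, 0, - p $ 1]"] exI[of _ "vector [0, p $ 3, - p $ 2]"]
          exI[of _ "vector [0, 0, 1 / p $ 3]"]) (auto simp: lin3 vec_eq_iff forall_3)
  next
    case 2
    then show ?thesis
      by (intro exI[of _ "vector [p $ 2, - p $ 1, 0]"] exI[of _ "vector [0, 0, 1]"]
          exI[of _ "vector [0, 1 / p $ 2, 0]"]) (auto simp: lin3 vec_eq_iff forall_3)
  next
    case 3
    then show ?thesis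
      by (intro exI[of _ "vector [0, 1, 0]"] exI[of _ "vector [0, 0, 1]"]
          exI[of _ "vector [1 / p $ 1, 0, 0]"]) (auto simp: lin3 vec_eq_iff forall_3)
  qed
qed

text \<open>Chain rule: the three brackets are the partial derivatives of \<open>cub\<close> in its
  arguments, multiplied by the entries of \<open>a\<close>, \<open>b\<close>,
  \<open>c\<close>.\<close>

lemma form_cub:
  "form 3 (\<lambda>x. cub \<alpha> \<beta> b0 b1 b2 c0 c1 c2 c3 (lin a x) (lin b x) (lin c x))
    (\<lambda>i x. (\<alpha> * (lin c x)^2 + (2 * b0 * lin a x + b1 * lin b x) * lin c x
          + (3 * c0 * (lin a x)^2 + 2 * c1 * lin a x * lin b x + c2 * (lin b x)^2)) * a $ i
      + (\<beta> * (lin c x)^2 + (b1 * lin a x + 2 * b2 * lin b x) * lin c x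
          + (c1 * (lin a x)^2 + 2 * c2 * lin a x * lin b x + 3 * c3 * (lin b x)^2)) * b $ i
      + (2 * (\<alpha> * lin a x + \<beta> * lin b x) * lin c x
          + (b0 * (lin a x)^2 + b1 * lin a x * lin b x + b2 * (lin b x)^2)) * c $ i)"
proof -
  note s = form_scaled_product3
  show ?thesis
    by (rule form_cong[OF form_add[OF form_add[OF form_add[OF form_add[OF form_add[OF form_add[OF form_add[OF form_add[OF
        s[of \<alpha> a c c] s[of \<beta> b c c]] s[of b0 a a c]] s[of b1 a b c]] s[of b2 b b c]]
        s[of c0 a a a]] s[of c1 a a b]] s[of c2 a b b]] s[of c3 b b b]]])
      (simp_all add: cub_def power2_eq_square power3_eq_cube algebra_simps)
qed

lemma form_quadratic:
  assumes "quadratic_form g"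
  shows "\<exists>E. form 2 (\<lambda>x. g (lin a x) (lin b x) (lin c x)) E"
proof -
  obtain p q r s t v where g: "\<And>x y z. g x y z = p * x^2 + q * x * y + r * y^2 + s * x * z + t * y * z + v * z^2"
    using assms unfolding quadratic_form_def by blast
  note s = form_scaled_product2
  show ?thesis
    by (rule exI, rule form_cong[OF form_add[OF form_add[OF form_add[OF form_add[OF form_add[OF
        s[of p a a] s[of q a b]] s[of r b b]] s[of s a c]] s[of t b c]] s[of v c c]]])
      (simp_all add: g power2_eq_square algebra_simps)
qed

locale pencil_of_lines = general_position v for v :: "nat \<Rightarrow> 'a::{field,finite} ^ 3" +
  fixes a b c :: "'a ^ 3"
  assumes a7: "lin a (v 7) = 0" and b7: "lin b (v 7) = 0" and c7: "lin c (v 7) = 1"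
    and kernel: "lin a x = 0 \<Longrightarrow> lin b x = 0 \<Longrightarrow> lin c x = 0 \<Longrightarrow> x = 0"
begin

lemma coordinates_surj: "\<exists>x. lin a x = p \<and> lin b x = q \<and> lin c x = r"
proof -
  let ?T = "\<lambda>x. (lin a x, lin b x, lin c x)"
  have "inj ?T"
  proof (rule injI)
    fix x y assume "?T x = ?T y"
    hence "x - y = 0" by (intro kernel) (auto simp: lin_diff_right)
    thus "x = y" by simp
  qed
  hence "card (range ?T) = CARD('a ^ 3)" by (simp add: card_image)
  hence "card (range ?T) = CARD('a \<times> 'a \<times> 'a)" by (simp add: power3_eq_cube)
  hence "range ?T = UNIV" by (intro card_subset_eq) auto
  hence "(p, q, r) \<in> range ?T" by simp
  thus ?thesis by auto
qed

lemma not_both_zero: "i < 7 \<Longrightarrow> \<not> (lin a (v i) = 0 \<and> lin b (v i) = 0)"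
proof
  assume i: "i < 7" and z: "lin a (v i) = 0 \<and> lin b (v i) = 0"
  have "v i - lin c (v i) *s v 7 = 0"
    by (rule kernel) (use z in \<open>simp_all add: lin_diff_right lin_smult_right a7 b7 c7\<close>)
  hence "v i = lin c (v i) *s v 7" by simp
  with distinct[of i 7] i show False by simp
qed

lemma line_through_two:
  assumes ij: "i < 7" "j < 7" "i \<noteq> j" and z: "lin d (v 7) = 0" "lin d (v i) = 0" "lin d (v j) = 0"
  shows "lin d x = 0"
proof (rule ccontr)
  assume "lin d x \<noteq> 0"
  hence "card {i\<in>{..<8}. lin d (v i) = 0} \<le> 2" by (rule on_line)
  moreover have "card {7, i, j} \<le> card {i\<in>{..<8}. lin d (v i) = 0}"
    by (rule card_mono) (use ij z in auto)
  ultimately show False using ij by simp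
qed

text \<open>The \<open>q + 1\<close> lines through \<open>v 7\<close> are the zero sets of \<open>a + t b\<close> and \<open>b\<close>; \<open>slope i\<close> tells which
  of them contains \<open>v i\<close>.\<close>

definition slope :: "nat \<Rightarrow> 'a option" where
  "slope i = (if lin b (v i) = 0 then None else Some (- lin a (v i) / lin b (v i)))"

text \<open>Two points of equal slope would be collinear with \<open>v 7\<close>.\<close>

lemma slope_inj: "inj_on slope {..<7}"
proof (rule inj_onI)
  fix i j assume ij: "i \<in> {..<7}" "j \<in> {..<7}" and e: "slope i = slope j"
  show "i = j"
  proof (rule ccontr)
    assume ne: "i \<noteq> j"
    show False
    proof (cases "slope i")
      case None
      have "lin b x = 0" for x
        by (rule line_through_two[of i j]) (use ij ne None e b7 in \<open>auto simp: slope_def split: if_splits\<close>)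
      moreover obtain x where "lin b x = 1" using coordinates_surj[of 0 1 0] by blast
      ultimately show False by simp
    next
      case (Some t)
      have t: "lin (a + t *s b) (v k) = 0" if "slope k = Some t" for k
        using that by (auto simp: slope_def lin_add lin_smult split: if_splits)
      have "lin (a + t *s b) x = 0" for x
        by (rule line_through_two[of i j]) (use ij ne t Some e a7 b7 in \<open>auto simp: lin_add lin_smult\<close>)
      moreover obtain x where "lin a x = 1" "lin b x = 0" using coordinates_surj[of 1 0 0] by blast
      ultimately show False using lin_add[of a "t *s b" x] by (simp add: lin_smult)
    qed
  qed
qed

lemma card_ge_6: "6 \<le> CARD('a)"
proof -
  have "7 = card (slope ` {..<7})" using slope_inj by (simp add: card_image)
  also have "\<dots> \<le> CARD('a option)" by (rule card_mono) auto
  finally show ?thesis by (simp add: card_UNIV_option)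
qed

text \<open>There are at least eight lines through \<open>v 7\<close> and the other points use
  seven. A free line is taken as \<open>y = 0\<close>, so that the other points have affine
  coordinates.\<close>

lemma unused_slope:
  assumes "7 \<le> CARD('a)"
  shows "\<exists>a' b'. pencil_of_lines v a' b' c \<and> (\<forall>i<7. lin b' (v i) \<noteq> 0)"
proof -
  have "card (slope ` {..<7}) < CARD('a option)"
    using slope_inj assms by (simp add: card_image card_UNIV_option)
  hence "slope ` {..<7} \<noteq> UNIV" by auto
  then obtain s where "s \<notin> slope ` {..<7}" by auto
  hence s: "slope i \<noteq> s" if "i < 7" for i using that by auto
  show ?thesis
  proof (cases s)
    case None
    have "lin b (v i) \<noteq> 0" if "i < 7" for i using s[OF that] None by (auto simp: slope_def)
    hence "\<forall>i<7. lin b (v i) \<noteq> 0" by blast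
    thus ?thesis using pencil_of_lines_axioms by blast
  next
    case (Some t)
    let ?b = "a + t *s b"
    have "lin ?b (v i) \<noteq> 0" if i: "i < 7" for i
    proof
      assume z: "lin ?b (v i) = 0"
      hence "lin a (v i) = - (t * lin b (v i))" by (simp add: lin_add lin_smult eq_neg_iff_add_eq_0)
      moreover from this not_both_zero[OF i] have "lin b (v i) \<noteq> 0" by auto
      ultimately have "slope i = Some t" by (simp add: slope_def)
      with s[OF i] Some show False by simp
    qed
    moreover have "pencil_of_lines v b ?b c"
      by unfold_locales (use a7 b7 c7 kernel in \<open>auto simp: lin_add lin_smult\<close>)
    ultimately show ?thesis by blast
  qed
qed

lemma normalised:
  assumes two: "(2::'a) \<noteq> 0" and three: "(3::'a) \<noteq> 0" and y: "\<And>i. i < 7 \<Longrightarrow> lin b (v i) \<noteq> 0"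
  shows "normalised_points (\<lambda>i. lin a (v i) / lin b (v i)) (\<lambda>i. lin c (v i) / lin b (v i))"
proof -
  define u where "u = (\<lambda>i. lin a (v i) / lin b (v i))"
  define w where "w = (\<lambda>i. lin c (v i) / lin b (v i))"
  have A: "lin a (v i) = lin b (v i) * u i" and C: "lin c (v i) = lin b (v i) * w i" if "i < 7" for i
    using y[OF that] by (auto simp: u_def w_def)
  have less8: "i < 8 \<longleftrightarrow> i < 7 \<or> i = 7" for i :: nat by auto
  have cub0: "cub \<alpha> \<beta> b0 b1 b2 c0 c1 c2 c3 (lin a (v i)) (lin b (v i)) (lin c (v i)) = 0"
    if "\<And>i. i < 7 \<Longrightarrow> cub \<alpha> \<beta> b0 b1 b2 c0 c1 c2 c3 (u i) 1 (w i) = 0" "i < 8" for \<alpha> \<beta> b0 b1 b2 c0 c1 c2 c3 i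
  proof (cases "i = 7")
    case True
    then show ?thesis by (simp add: a7 b7 c7 cub_def)
  next
    case False
    hence i: "i < 7" using that(2) by simp
    show ?thesis unfolding A[OF i] C[OF i]
      using cub_homogeneous[of \<alpha> \<beta> b0 b1 b2 c0 c1 c2 c3 "lin b (v i)" "u i" 1 "w i"] that(1)[OF i] by simp
  qed
  have "normalised_points u w"
  proof
    show "(2::'a) \<noteq> 0" "(3::'a) \<noteq> 0" by fact+
    show "inj_on u {..<7}"
    proof (rule inj_onI)
      fix i j assume ij: "i \<in> {..<7}" "j \<in> {..<7}" and e: "u i = u j"
      hence "slope i = slope j" using y by (auto simp: slope_def u_def)
      thus "i = j" using slope_inj ij by (auto dest: inj_onD)
    qed
  next
    fix f x y z
    assume f: "contains_line f" and f7: "f 0 0 1 = 0" and fi: "\<And>i. i < 7 \<Longrightarrow> f (u i) 1 (w i) = 0"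
    obtain l g where l: "linear_form l" and g: "quadratic_form g" and lg: "\<And>x y z. f x y z = l x y z * g x y z"
      using f unfolding contains_line_def by blast
    obtain p q r where L: "\<And>x y z. l x y z = p * x + q * y + r * z"
      using l unfolding linear_form_def by blast
    obtain p' q' r' s' t' v' where G: "\<And>x y z. g x y z = p' * x^2 + q' * x * y + r' * y^2 + s' * x * z + t' * y * z + v' * z^2"
      using g unfolding quadratic_form_def by blast
    obtain E where E: "form 2 (\<lambda>x. g (lin a x) (lin b x) (lin c x)) E" using form_quadratic[OF g] by blast
    define d where "d = p *s a + q *s b + r *s c"
    have d: "lin d X = l (lin a X) (lin b X) (lin c X)" for X
      by (simp add: d_def lin_add lin_smult L)
    let ?l = "\<lambda>i. lin d (v i)" and ?g = "\<lambda>i. g (lin a (v i)) (lin b (v i)) (lin c (v i))"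
    have z: "?l i = 0 \<or> ?g i = 0" if "i < 8" for i
    proof (cases "i = 7")
      case True
      then show ?thesis using f7 by (simp add: lg d a7 b7 c7)
    next
      case False
      hence i: "i < 7" using that by simp
      have "?l i = lin b (v i) * l (u i) 1 (w i)"
        unfolding d A[OF i] C[OF i] L by (simp add: algebra_simps)
      moreover have "?g i = lin b (v i) ^ 2 * g (u i) 1 (w i)"
        unfolding A[OF i] C[OF i] G by (simp add: power2_eq_square algebra_simps)
      ultimately show ?thesis using fi[OF i] by (auto simp: lg)
    qed
    show "f x y z = 0"
    proof (rule ccontr)
      assume nz: "f x y z \<noteq> 0"
      obtain X where X: "lin a X = x" "lin b X = y" "lin c X = z" using coordinates_surj by blast
      have "lin d X \<noteq> 0" using nz by (auto simp: d X lg)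
      hence 1: "card {i\<in>{..<8}. ?l i = 0} \<le> 2" by (rule on_line)
      have 2: "card {i\<in>{..<8}. ?g i = 0} \<le> 5"
        by (rule on_conic[OF E, of X]) (use nz in \<open>auto simp: X lg\<close>)
      \<comment> \<open>The line and the conic together would have to contain all eight points but
        contain at most \<open>2 + 5\<close>.\<close>
      have "{..<8} \<subseteq> {i\<in>{..<8}. ?l i = 0} \<union> {i\<in>{..<8}. ?g i = 0}" using z by auto
      hence "card {..<8::nat} \<le> card ({i\<in>{..<8}. ?l i = 0} \<union> {i\<in>{..<8}. ?g i = 0})"
        by (intro card_mono) auto
      also have "\<dots> \<le> card {i\<in>{..<8}. ?l i = 0} + card {i\<in>{..<8}. ?g i = 0}" by (rule card_Un_le)
      finally show False using 1 2 by simp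
    qed
  next
    fix b0 b1 b2 c0 c1 c2 c3 x y z
    assume v: "\<And>i. i < 7 \<Longrightarrow> cub 0 0 b0 b1 b2 c0 c1 c2 c3 (u i) 1 (w i) = 0"
    obtain X where X: "lin a X = x" "lin b X = y" "lin c X = z" using coordinates_surj by blast
    show "cub 0 0 b0 b1 b2 c0 c1 c2 c3 x y z = 0"
    proof (rule ccontr)
      assume "\<not> ?thesis"
      \<comment> \<open>For \<open>\<alpha> = \<beta> = 0\<close> all three partial derivatives
        vanish at the vertex \<open>(0, 0, 1)\<close>.\<close>
      with cubic_nonsingular[OF form_cub[of 0 0 b0 b1 b2 c0 c1 c2 c3 a b c], of X 7] cub0[OF v] show False
        by (simp add: X a7 b7 c7)
    qed
  next
    fix \<alpha> \<beta> b0 b1 b2 c0 c1 c2 c3 x y z j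
    assume v: "\<And>i. i < 7 \<Longrightarrow> cub \<alpha> \<beta> b0 b1 b2 c0 c1 c2 c3 (u i) 1 (w i) = 0" and j: "j < 7"
      and fx: "\<alpha> * (w j)^2 + (2 * b0 * u j + b1) * w j + (3 * c0 * (u j)^2 + 2 * c1 * u j + c2) = 0"
      and fz: "2 * (\<alpha> * u j + \<beta>) * w j + (b0 * (u j)^2 + b1 * u j + b2) = 0"
    obtain X where X: "lin a X = x" "lin b X = y" "lin c X = z" using coordinates_surj by blast
    let ?y = "lin b (v j)"
    \<comment> \<open>Euler's relation\<close>
    have "\<beta> * (w j)^2 + (b1 * u j + 2 * b2) * w j + (c1 * (u j)^2 + 2 * c2 * u j + 3 * c3)
        = 3 * cub \<alpha> \<beta> b0 b1 b2 c0 c1 c2 c3 (u j) 1 (w j)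
          - u j * (\<alpha> * (w j)^2 + (2 * b0 * u j + b1) * w j + (3 * c0 * (u j)^2 + 2 * c1 * u j + c2))
          - w j * (2 * (\<alpha> * u j + \<beta>) * w j + (b0 * (u j)^2 + b1 * u j + b2))"
      by (simp add: cub_def power2_eq_square power3_eq_cube algebra_simps)
    hence fy: "\<beta> * (w j)^2 + (b1 * u j + 2 * b2) * w j + (c1 * (u j)^2 + 2 * c2 * u j + 3 * c3) = 0"
      using v[OF j] fx fz by simp
    \<comment> \<open>The partial derivatives are homogeneous of degree 2, so passing from
      \<open>(u j, 1, w j)\<close> to the coordinates of \<open>v j\<close> multiplies them by the
      square of the second coordinate.\<close>
    have Fx: "\<alpha> * (lin c (v j))^2 + (2 * b0 * lin a (v j) + b1 * lin b (v j)) * lin c (v j)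
          + (3 * c0 * (lin a (v j))^2 + 2 * c1 * lin a (v j) * lin b (v j) + c2 * (lin b (v j))^2)
        = ?y^2 * (\<alpha> * (w j)^2 + (2 * b0 * u j + b1) * w j + (3 * c0 * (u j)^2 + 2 * c1 * u j + c2))"
      unfolding A[OF j] C[OF j] by (simp add: power2_eq_square algebra_simps)
    have Fy: "\<beta> * (lin c (v j))^2 + (b1 * lin a (v j) + 2 * b2 * lin b (v j)) * lin c (v j)
          + (c1 * (lin a (v j))^2 + 2 * c2 * lin a (v j) * lin b (v j) + 3 * c3 * (lin b (v j))^2)
        = ?y^2 * (\<beta> * (w j)^2 + (b1 * u j + 2 * b2) * w j + (c1 * (u j)^2 + 2 * c2 * u j + 3 * c3))"
      unfolding A[OF j] C[OF j] by (simp add: power2_eq_square algebra_simps)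
    have Fz: "2 * (\<alpha> * lin a (v j) + \<beta> * lin b (v j)) * lin c (v j)
          + (b0 * (lin a (v j))^2 + b1 * lin a (v j) * lin b (v j) + b2 * (lin b (v j))^2)
        = ?y^2 * (2 * (\<alpha> * u j + \<beta>) * w j + (b0 * (u j)^2 + b1 * u j + b2))"
      unfolding A[OF j] C[OF j] by (simp add: power2_eq_square algebra_simps)
    show "cub \<alpha> \<beta> b0 b1 b2 c0 c1 c2 c3 x y z = 0"
    proof (rule ccontr)
      assume nz: "\<not> ?thesis"
      have "\<exists>k. (\<alpha> * (lin c (v j))^2 + (2 * b0 * lin a (v j) + b1 * lin b (v j)) * lin c (v j)
          + (3 * c0 * (lin a (v j))^2 + 2 * c1 * lin a (v j) * lin b (v j) + c2 * (lin b (v j))^2)) * a $ k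
      + (\<beta> * (lin c (v j))^2 + (b1 * lin a (v j) + 2 * b2 * lin b (v j)) * lin c (v j)
          + (c1 * (lin a (v j))^2 + 2 * c2 * lin a (v j) * lin b (v j) + 3 * c3 * (lin b (v j))^2)) * b $ k
      + (2 * (\<alpha> * lin a (v j) + \<beta> * lin b (v j)) * lin c (v j)
          + (b0 * (lin a (v j))^2 + b1 * lin a (v j) * lin b (v j) + b2 * (lin b (v j))^2)) * c $ k \<noteq> 0"
        by (rule cubic_nonsingular[OF form_cub[of \<alpha> \<beta> b0 b1 b2 c0 c1 c2 c3 a b c], of X j])
          (use nz j cub0[OF v] in \<open>auto simp: X\<close>)
      thus False unfolding Fx Fy Fz fx fy fz by simp
    qed
  qed
  thus ?thesis unfolding u_def w_def .
qed

end

theorem theorem6p5: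
  assumes "CARD('p::prime_card) < 17"
  shows "\<not> (\<exists>S :: ('p mod_ring ^ 3) set set. eight_points_in_general_position S)"
proof
  assume "\<exists>S :: ('p mod_ring ^ 3) set set. eight_points_in_general_position S"
  then obtain v :: "nat \<Rightarrow> 'p mod_ring ^ 3" where "general_position v"
    using general_position_of_eight_points by blast
  then interpret general_position v .
  obtain a b c where "lin a (v 7) = 0" "lin b (v 7) = 0" "lin c (v 7) = 1"
    "\<And>x. lin a x = 0 \<Longrightarrow> lin b x = 0 \<Longrightarrow> lin c x = 0 \<Longrightarrow> x = 0"
    using coordinates_at[OF nonzero[of 7]] by auto
  then interpret pencil_of_lines v a b c by unfold_locales
  let ?p = "CARD('p)"
  have "6 \<le> ?p" using card_ge_6 by simp
  moreover have "prime ?p" by (rule prime_card)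
  ultimately have "?p \<in> {p\<in>{6..<17}. prime p}" using assms by simp
  also have "{p\<in>{6..<17}. prime p} = {7, 11, 13::nat}" by code_simp
  finally have p: "?p = 7 \<or> ?p = 11 \<or> ?p = 13" by simp
  have char: "of_nat k \<noteq> (0 :: 'p mod_ring)" if "0 < k" "k < ?p" for k
    using of_nat_0_mod_ring_dvd[of k, where ?'a = 'p] that nat_dvd_not_less by blast
  have two: "(2 :: 'p mod_ring) \<noteq> 0" and three: "(3 :: 'p mod_ring) \<noteq> 0"
    using char[of 2] char[of 3] p by auto
  obtain a' b' where "pencil_of_lines v a' b' c" and y: "\<And>i. i < 7 \<Longrightarrow> lin b' (v i) \<noteq> 0"
    using unused_slope p by auto
  then interpret P: pencil_of_lines v a' b' c by simp
  interpret N: normalised_points "\<lambda>i. lin a' (v i) / lin b' (v i)" "\<lambda>i. lin c (v i) / lin b' (v i)"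
    using P.normalised[OF two three y] .
  have main: "?p * ?p^3 + (?p^2 - ?p) * (1 + 9 * (?p - 1)) \<le> ?p^3 + (?p^2 - 1) * (?p + (?p - 1) * B)"
    if "cubic_counts_le ?p (square_root_counts ?p) B" for B
    using N.points_count[OF card_cubic_curve_le[OF that]] by simp
  from p show False
  \<comment> \<open>In the three cases \<open>main\<close> would read 4711 \<le> 4423, 24651 \<le>
    24251 and 45565 \<le> 44701.\<close>
  proof (elim disjE)
    assume p: "?p = 7"
    with main[of 13] cubic_counts_7 show False by simp
  next
    assume p: "?p = 11"
    with main[of 18] cubic_counts_11 show False by simp
  next
    assume p: "?p = 13"
    with main[of 20] cubic_counts_13 show False by simp
  qed
qed

end
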